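(* Let $n\ge1$ and let $h_n\in\mathbb Z[X_1,\dots,X_n]$ be the polynomial defined in the context. Let $f=X^n+a_1X^{n-1}+\cdots+a_n\in\mathbb F_q[X]$ be irreducible. If $h_n(a_1,\dots,a_n)\ne0$, then $f$ is normal over $\mathbb F_q$, i.e., its roots are linearly independent over $\mathbb F_q$.
   Context: For $m\ge1$ let $\epsilon_m=e^{2\pi\sqrt{-1}/m}$ and $\Psi_m(X_0,\dots,X_{m-1})=\prod_{i\in(\mathbb Z/m\mathbb Z)^\times}\bigl(\sum_{j\in\mathbb Z/m\mathbb Z}\epsilon_m^{ij}X_j\bigr)$, which lies in $\mathbb Z[X_0,\dots,X_{m-1}]$. Let $S_m$ act on polynomials in $X_0,\dots,X_{m-1}$ by $\sigma(X_j)=X_{\sigma(j)}$, let $\mathrm{Stab}(\Psi_m)$ be the stabilizer of $\Psi_m$, let $\mathcal C_m$ be a system of representatives of the left cosets of $\mathrm{Stab}(\Psi_m)$ in $S_m$, and set $\Phi_m=\prod_{\sigma\in\mathcal C_m}\sigma(\Psi_m)$ (a symmetric polynomial in $\mathbb Z[X_0,\dots,X_{m-1}]$, independent of the choice of $\mathcal C_m$). For $m\mid n$, let $\mathcal P_{n,m}$ be the set of unordered partitions of $\{0,1,\dots,n-1\}$ into $m$ parts $P_0,\dots,P_{m-1}$ each of size $n/m$, and define \[ \Theta_{n,m}(X_0,\dots,X_{n-1})=\prod_{\{P_0,\dots,P_{m-1}\}\in\mathcal P_{n,m}}\Phi_m\Bigl(\sum_{a\in P_0}X_a,\dots,\sum_{a\in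 P_{m-1}}X_a\Bigr) \] (well defined since $\Phi_m$ is symmetric). $\Theta_{n,m}$ is a symmetric polynomial in $\mathbb Z[X_0,\dots,X_{n-1}]$, so there is a unique $\theta_{n,m}\in\mathbb Z[X_1,\dots,X_n]$ with $\Theta_{n,m}(X_0,\dots,X_{n-1})=\theta_{n,m}(s_1,\dots,s_n)$, where $s_i$ is the $i$-th elementary symmetric polynomial in $X_0,\dots,X_{n-1}$. Finally $h_n=\prod_{m\mid n}\theta_{n,m}$. *)

theory Defs
  imports Complex_Main "HOL-Library.Poly_Mapping" "HOL-Library.Disjoint_Sets"
    "HOL-Combinatorics.Permutations" "HOL-Computational_Algebra.Polynomial"
begin

text \<open>Multivariate polynomials in variables X_0, X_1, ... (indexed by nat):
  a monomial is a finitely supported exponent vector, a polynomial a finitely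
  supported coefficient function on monomials (library type poly_mapping,
  which is a commutative ring under convolution).\<close>

type_synonym 'a mpoly = "(nat \<Rightarrow>\<^sub>0 nat) \<Rightarrow>\<^sub>0 'a"

definition mVar :: "nat \<Rightarrow> 'a::comm_ring_1 mpoly" where
  "mVar i = Poly_Mapping.single (Poly_Mapping.single i 1) 1"

definition mConst :: "'a::comm_ring_1 \<Rightarrow> 'a mpoly" where
  "mConst c = Poly_Mapping.single 0 c"

definition mpoly_ins :: "('a::zero \<Rightarrow> 'b::comm_semiring_1) \<Rightarrow> (nat \<Rightarrow> 'b) \<Rightarrow> 'a mpoly \<Rightarrow> 'b" where
  "mpoly_ins c g p =
     (\<Sum>m\<in>Poly_Mapping.keys p. c (Poly_Mapping.lookup p m) *
        (\<Prod>i\<in>Poly_Mapping.keys m. g i ^ Poly_Mapping.lookup m i))"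

definition mpoly_vars :: "'a::zero mpoly \<Rightarrow> nat set" where
  "mpoly_vars p = \<Union> (Poly_Mapping.keys ` Poly_Mapping.keys p)"

definition mrename :: "(nat \<Rightarrow> nat) \<Rightarrow> 'a::comm_ring_1 mpoly \<Rightarrow> 'a mpoly" where
  "mrename \<sigma> p = mpoly_ins mConst (\<lambda>j. mVar (\<sigma> j)) p"

text \<open>Psi_m = prod over i in (Z/mZ)^x of (sum_j eps_m^(i j) X_j), eps_m = exp(2 pi sqrt(-1)/m);
  residues mod m represented by 0..m-1.\<close>
definition Psi :: "nat \<Rightarrow> complex mpoly" where
  "Psi m = (\<Prod>i\<in>{i. i < m \<and> coprime i m}.
              \<Sum>j<m. mConst (cis (2 * pi / real m) ^ (i * j)) * mVar j)"

definition Stab_Psi :: "nat \<Rightarrow> (nat \<Rightarrow> nat) set" where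
  "Stab_Psi m = {\<sigma>. \<sigma> permutes {..<m} \<and> mrename \<sigma> (Psi m) = Psi m}"

definition coset_reps :: "nat \<Rightarrow> (nat \<Rightarrow> nat) set \<Rightarrow> bool" where
  "coset_reps m C \<longleftrightarrow> C \<subseteq> {\<sigma>. \<sigma> permutes {..<m}} \<and>
     (\<forall>\<sigma>. \<sigma> permutes {..<m} \<longrightarrow> (\<exists>!\<tau>. \<tau> \<in> C \<and> (\<exists>\<rho>\<in>Stab_Psi m. \<sigma> = \<tau> \<circ> \<rho>)))"

definition Phi :: "nat \<Rightarrow> complex mpoly" where
  "Phi m = (\<Prod>\<sigma>\<in>(SOME C. coset_reps m C). mrename \<sigma> (Psi m))"

definition part_set :: "nat \<Rightarrow> nat \<Rightarrow> nat set set set" where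
  "part_set n m = {P. partition_on {..<n} P \<and> card P = m \<and> (\<forall>B\<in>P. card B = n div m)}"

definition Theta :: "nat \<Rightarrow> nat \<Rightarrow> complex mpoly" where
  "Theta n m = (\<Prod>P\<in>part_set n m.
      (let g = (SOME g. bij_betw g {..<m} P)
       in mpoly_ins mConst (\<lambda>j. if j < m then (\<Sum>a\<in>g j. mVar a) else 0) (Phi m)))"

definition esym :: "nat \<Rightarrow> nat \<Rightarrow> 'a::comm_ring_1 mpoly" where
  "esym n i = (\<Sum>S\<in>{S. S \<subseteq> {..<n} \<and> card S = i}. \<Prod>j\<in>S. mVar j)"

definition theta :: "nat \<Rightarrow> nat \<Rightarrow> int mpoly" where
  "theta n m = (THE p. mpoly_vars p \<subseteq> {1..n} \<and> mpoly_ins of_int (\<lambda>i. esym n i) p = Theta n m)"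

definition h :: "nat \<Rightarrow> int mpoly" where
  "h n = (\<Prod>m\<in>{m. m dvd n}. theta n m)"

end

theory Submission
  imports "HOL-Algebra.Algebraic_Closure_Type" "HOL-Library.Cardinality" Defs
begin

text \<open>If the conjugates \<open>u i = r^(q^i)\<close> of a root \<open>r\<close> satisfy a nontrivial linear relation over
  \<open>GF(q)\<close>, Frobenius turns it into a linear recurrence for the \<open>n\<close>-periodic sequence \<open>u\<close>. Its minimal
  polynomial over an algebraically closed field is a proper divisor of \<open>X^n - 1\<close>, so
  \<open>(X^n - 1)/(X - \<delta>)\<close> annihilates \<open>u\<close> for some \<open>n\<close>-th root of unity \<open>\<delta>\<close>, that is,
  \<open>\<Sum> \<epsilon>^i u i = 0\<close> with \<open>\<epsilon> = 1/\<delta>\<close>. If \<open>\<epsilon>\<close> has order \<open>m\<close>, grouping by residues modulo \<open>m\<close> makes one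
  linear factor of \<open>Psi m\<close> vanish at the block sums of the partition into residue classes; hence
  \<open>theta n m\<close> vanishes at the coefficients of \<open>f\<close>.

  For this, the factorisation of \<open>Psi m\<close> has to be transported from the complex numbers: \<open>Psi m\<close> has
  integer coefficients, and \<open>\<int>[\<zeta>]\<close> maps to any algebraically closed field by sending \<open>\<zeta>\<close> to a root of
  its minimal polynomial over \<open>\<int>\<close>. Every \<open>m\<close>-th root of unity of the target is then a power of the
  image of \<open>\<zeta>\<close>, since \<open>X^m - 1 = \<Prod> (X - \<zeta>^i)\<close> is preserved.\<close>

abbreviation "lookup \<equiv> Poly_Mapping.lookup"
abbreviation "keys \<equiv> Poly_Mapping.keys"

section \<open>Unital homomorphisms of commutative rings\<close>

locale unital_ring_hom =
  fixes F :: "'a::comm_ring_1 \<Rightarrow> 'b::comm_ring_1"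
  assumes one [simp]: "F 1 = 1"
    and add: "F (x + y) = F x + F y"
    and mult: "F (x * y) = F x * F y"
begin

lemma zero [simp]: "F 0 = 0"
  using add[of 0 0] by simp

lemma uminus: "F (- x) = - F x"
  using add[of x "- x"] by (simp add: eq_neg_iff_add_eq_0 add.commute)

lemma diff: "F (x - y) = F x - F y"
  using add[of x "- y"] by (simp add: uminus)

lemma sum: "F (sum f A) = (\<Sum>x\<in>A. F (f x))"
  by (induction A rule: infinite_finite_induct) (simp_all add: add)

lemma prod: "F (prod f A) = (\<Prod>x\<in>A. F (f x))"
  by (induction A rule: infinite_finite_induct) (simp_all add: mult)

lemma power: "F (x ^ k) = F x ^ k"
  by (induction k) (simp_all add: mult)

lemma of_nat: "F (of_nat k) = of_nat k"
  by (induction k) (simp_all add: add)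

lemma of_int: "F (of_int k) = of_int k"
  by (cases k rule: int_cases2) (simp_all add: of_nat uminus)

end

lemma unital_ring_hom_of_int: "unital_ring_hom (of_int :: int \<Rightarrow> 'a::comm_ring_1)"
  by standard simp_all

lemma unital_ring_hom_comp:
  assumes "unital_ring_hom F" "unital_ring_hom G"
  shows "unital_ring_hom (\<lambda>x. F (G x))"
proof -
  interpret F: unital_ring_hom F by fact
  interpret G: unital_ring_hom G by fact
  show ?thesis by standard (simp_all add: F.add F.mult G.add G.mult)
qed

section \<open>Evaluation of multivariate polynomials\<close>

text \<open>The inner product of \<open>mpoly_ins\<close>, isolated because its multiplicativity in
  the exponent vector drives the evaluation rules.\<close>

definition mono_eval :: "(nat \<Rightarrow> 'b::comm_semiring_1) \<Rightarrow> (nat \<Rightarrow>\<^sub>0 nat) \<Rightarrow> 'b" where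
  "mono_eval g m = (\<Prod>i\<in>keys m. g i ^ lookup m i)"

lemma mono_eval_superset:
  assumes "finite A" "keys m \<subseteq> A"
  shows "mono_eval g m = (\<Prod>i\<in>A. g i ^ lookup m i)"
  unfolding mono_eval_def using assms
  by (intro prod.mono_neutral_left) (auto simp: in_keys_iff)

lemma mono_eval_add: "mono_eval g (a + b) = mono_eval g a * mono_eval g b"
proof -
  let ?A = "keys a \<union> keys b"
  have "keys (a + b) \<subseteq> ?A"
    by (rule Poly_Mapping.keys_add)
  then show ?thesis
    by (simp add: mono_eval_superset[of ?A] lookup_add power_add prod.distrib)
qed

lemma mono_eval_0 [simp]: "mono_eval g 0 = 1"
  by (simp add: mono_eval_def)

lemma mono_eval_single [simp]: "mono_eval g (Poly_Mapping.single i k) = g i ^ k"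
  by (cases "k = 0") (simp_all add: mono_eval_def)

text \<open>Keys may cancel in sums, so polynomials with different supports are compared over one
  common index set.\<close>

lemma mpoly_ins_superset:
  assumes "finite A" "keys p \<subseteq> A" "c 0 = 0"
  shows "mpoly_ins c g p = (\<Sum>m\<in>A. c (lookup p m) * mono_eval g m)"
  unfolding mpoly_ins_def mono_eval_def[symmetric] using assms
  by (intro sum.mono_neutral_left) (auto simp: in_keys_iff)

lemma mpoly_ins_single:
  assumes "c 0 = 0"
  shows "mpoly_ins c g (Poly_Mapping.single m a) = c a * mono_eval g m"
  using mpoly_ins_superset[of "{m}" "Poly_Mapping.single m a" c g] assms by simp

lemma mpoly_ins_add:
  assumes "unital_ring_hom c"
  shows "mpoly_ins c g (p + q) = mpoly_ins c g p + mpoly_ins c g q"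
proof -
  interpret c: unital_ring_hom c by fact
  let ?A = "keys p \<union> keys q"
  have "keys (p + q) \<subseteq> ?A"
    by (rule Poly_Mapping.keys_add)
  then show ?thesis
    by (simp add: mpoly_ins_superset[of ?A] lookup_add c.add distrib_right sum.distrib)
qed

lemma mpoly_ins_sum:
  assumes "unital_ring_hom c"
  shows "mpoly_ins c g (sum f A) = (\<Sum>x\<in>A. mpoly_ins c g (f x))"
  by (induction A rule: infinite_finite_induct) (simp_all add: mpoly_ins_add[OF assms], simp_all add: mpoly_ins_def)

lemma mpoly_eq_sum_single:
  "p = (\<Sum>m\<in>keys p. Poly_Mapping.single m (lookup p m))"
proof (rule poly_mapping_eqI)
  fix k
  have "lookup (\<Sum>m\<in>keys p. Poly_Mapping.single m (lookup p m)) k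
      = (\<Sum>m\<in>keys p. if m = k then lookup p m else 0)"
    unfolding lookup_sum by (rule sum.cong) (auto simp: lookup_single)
  also have "\<dots> = lookup p k"
    by (simp add: in_keys_iff)
  finally show "lookup p k =
    lookup (\<Sum>m\<in>keys p. Poly_Mapping.single m (lookup p m)) k" ..
qed

text \<open>For multiplicativity, additivity reduces both sides to products of single terms, where
  \<open>mono_eval_add\<close> applies.\<close>

lemma unital_ring_hom_mpoly_ins:
  fixes c :: "'a::comm_ring_1 \<Rightarrow> 'b::comm_ring_1"
  assumes "unital_ring_hom c"
  shows "unital_ring_hom (mpoly_ins c g)"
proof
  interpret c: unital_ring_hom c by fact
  show "mpoly_ins c g 1 = 1"
    by (simp add: mpoly_ins_single flip: single_one)
  fix p q :: "'a mpoly"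
  show "mpoly_ins c g (p + q) = mpoly_ins c g p + mpoly_ins c g q"
    by (rule mpoly_ins_add) fact
  have "mpoly_ins c g (p * q) = mpoly_ins c g
     (\<Sum>m\<in>keys p. \<Sum>m'\<in>keys q.
       Poly_Mapping.single (m + m') (lookup p m * lookup q m'))"
    by (subst mpoly_eq_sum_single[of p], subst mpoly_eq_sum_single[of q])
       (simp add: sum_product mult_single)
  also have "\<dots> = (\<Sum>m\<in>keys p. \<Sum>m'\<in>keys q.
     (c (lookup p m) * mono_eval g m) * (c (lookup q m') * mono_eval g m'))"
    by (simp add: mpoly_ins_sum[OF assms] mpoly_ins_single c.mult mono_eval_add mult_ac)
  also have "\<dots> = mpoly_ins c g p * mpoly_ins c g q"
    by (simp add: mpoly_ins_def mono_eval_def sum_product)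
  finally show "mpoly_ins c g (p * q) = mpoly_ins c g p * mpoly_ins c g q" .
qed

lemma mpoly_ins_mVar [simp]: "unital_ring_hom c \<Longrightarrow> mpoly_ins c g (mVar i) = g i"
  by (simp add: mVar_def mpoly_ins_single unital_ring_hom.zero unital_ring_hom.one)

lemma mpoly_ins_mConst [simp]: "unital_ring_hom c \<Longrightarrow> mpoly_ins c g (mConst a) = c a"
  by (simp add: mConst_def mpoly_ins_single unital_ring_hom.zero)

lemma unital_ring_hom_mConst: "unital_ring_hom (mConst :: 'a::comm_ring_1 \<Rightarrow> 'a mpoly)"
  by standard (simp_all add: mConst_def single_add mult_single)

lemma mConst_int [simp]: "(mConst k :: int mpoly) = of_int k"
  using unital_ring_hom.of_int[OF unital_ring_hom_mConst[where 'a=int], of k] by simp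

lemma single_eq_mConst_mono_eval: "Poly_Mapping.single m a = mConst a * mono_eval mVar m"
proof -
  have pow: "mVar i ^ k = (Poly_Mapping.single (Poly_Mapping.single i k) 1 :: 'a mpoly)" for i k
    by (induction k) (simp_all add: mVar_def mult_single flip: single_add)
  have *: "(\<Prod>i\<in>A. mVar i ^ lookup m i) =
     (Poly_Mapping.single (\<Sum>i\<in>A. Poly_Mapping.single i (lookup m i)) 1 :: 'a mpoly)"
    if "finite A" for A
    using that by (induction A) (simp_all add: pow mult_single)
  have "m = (\<Sum>i\<in>keys m. Poly_Mapping.single i (lookup m i))"
  proof (rule poly_mapping_eqI)
    fix k
    have "lookup (\<Sum>i\<in>keys m. Poly_Mapping.single i (lookup m i)) k
        = (\<Sum>i\<in>keys m. if i = k then lookup m i else 0)"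
      unfolding lookup_sum by (rule sum.cong) (auto simp: lookup_single)
    also have "\<dots> = lookup m k"
      by (simp add: in_keys_iff)
    finally show "lookup m k =
      lookup (\<Sum>i\<in>keys m. Poly_Mapping.single i (lookup m i)) k" ..
  qed
  with * show ?thesis
    by (simp add: mono_eval_def mConst_def mult_single)
qed

text \<open>Universal property of the polynomial ring. It identifies compositions of evaluations,
  renamings and coefficient maps by comparing them on constants and variables only.\<close>

lemma unital_ring_hom_mpoly_eq:
  fixes F :: "'a::comm_ring_1 mpoly \<Rightarrow> 'b::comm_ring_1"
  assumes "unital_ring_hom F"
  shows "F p = mpoly_ins (\<lambda>a. F (mConst a)) (\<lambda>i. F (mVar i)) p"
proof -
  interpret F: unital_ring_hom F by fact
  show ?thesis
    by (subst mpoly_eq_sum_single[of p])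
       (simp add: F.sum F.mult single_eq_mConst_mono_eval mpoly_ins_def mono_eval_def F.prod F.power)
qed

lemma unital_ring_hom_int_mpoly_eq:
  fixes F :: "int mpoly \<Rightarrow> 'b::comm_ring_1"
  assumes "unital_ring_hom F"
  shows "F p = mpoly_ins of_int (\<lambda>i. F (mVar i)) p"
  using unital_ring_hom_mpoly_eq[OF assms, of p] unital_ring_hom.of_int[OF assms] by simp

text \<open>Over the integers the coefficient map is forced, so a homomorphism passes straight to
  the arguments. This is the main transport rule between integer polynomials and the rings in which
  they are evaluated.\<close>

lemma unital_ring_hom_mpoly_ins_int:
  fixes F :: "'a::comm_ring_1 \<Rightarrow> 'b::comm_ring_1"
  assumes "unital_ring_hom F"
  shows "F (mpoly_ins of_int g p) = mpoly_ins of_int (\<lambda>i. F (g i)) p"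
  using unital_ring_hom_int_mpoly_eq
    [OF unital_ring_hom_comp[OF assms unital_ring_hom_mpoly_ins[OF unital_ring_hom_of_int]]]
  by (simp add: unital_ring_hom_of_int)

lemma mpoly_ins_cong_vars:
  assumes "\<And>i. i \<in> mpoly_vars p \<Longrightarrow> g i = g' i"
  shows "mpoly_ins c g p = mpoly_ins c g' p"
  unfolding mpoly_ins_def
  by (intro sum.cong prod.cong refl arg_cong2[where f="(*)"] arg_cong2[where f="(^)"] assms)
     (auto simp: mpoly_vars_def)

section \<open>Symmetric polynomials\<close>

lemma mpoly_vars_add: "mpoly_vars (p + q) \<subseteq> mpoly_vars p \<union> mpoly_vars q"
  unfolding mpoly_vars_def using Poly_Mapping.keys_add[of p q] by blast

lemma mpoly_vars_mult:
  fixes p q :: "'a::comm_ring_1 mpoly"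
  shows "mpoly_vars (p * q) \<subseteq> mpoly_vars p \<union> mpoly_vars q"
proof
  fix i assume "i \<in> mpoly_vars (p * q)"
  then obtain v where "v \<in> keys (p * q)" "i \<in> keys v" by (auto simp: mpoly_vars_def)
  with keys_mult[of p q] obtain a b where "i \<in> keys (a + b)" "a \<in> keys p" "b \<in> keys q" by blast
  with Poly_Mapping.keys_add[of a b] show "i \<in> mpoly_vars p \<union> mpoly_vars q"
    by (auto simp: mpoly_vars_def)
qed

lemma mpoly_vars_uminus: "mpoly_vars (- p :: 'a::ab_group_add mpoly) = mpoly_vars p"
  by (auto simp: mpoly_vars_def in_keys_iff)

lemma mpoly_vars_sum_subset:
  "(\<And>x. x \<in> A \<Longrightarrow> mpoly_vars (f x) \<subseteq> V) \<Longrightarrow> mpoly_vars (sum f A) \<subseteq> V"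
proof (induction A rule: infinite_finite_induct)
  case (insert x A)
  then show ?case using mpoly_vars_add[of "f x" "sum f A"] by auto
qed (simp_all add: mpoly_vars_def)

lemma mpoly_vars_prod_subset:
  fixes f :: "'b \<Rightarrow> 'a::comm_ring_1 mpoly"
  shows "(\<And>x. x \<in> A \<Longrightarrow> mpoly_vars (f x) \<subseteq> V) \<Longrightarrow> mpoly_vars (prod f A) \<subseteq> V"
proof (induction A rule: infinite_finite_induct)
  case (insert x A)
  then show ?case using mpoly_vars_mult[of "f x" "prod f A"] by auto
qed (simp_all add: mpoly_vars_def)

lemma mpoly_vars_mVar: "mpoly_vars (mVar i :: 'a::comm_ring_1 mpoly) \<subseteq> {i}"
  by (auto simp: mpoly_vars_def mVar_def)

lemma mpoly_vars_mConst: "mpoly_vars (mConst a) = {}"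
  by (auto simp: mpoly_vars_def mConst_def)

lemma mpoly_vars_power_subset:
  fixes p :: "'a::comm_ring_1 mpoly"
  shows "mpoly_vars p \<subseteq> V \<Longrightarrow> mpoly_vars (p ^ k) \<subseteq> V"
  using mpoly_vars_prod_subset[of "{..<k}" "\<lambda>_. p"] by simp

lemma mpoly_vars_mpoly_ins_subset:
  fixes c :: "'c::zero \<Rightarrow> 'a::comm_ring_1 mpoly"
  assumes "\<And>a. mpoly_vars (c a) \<subseteq> V" "\<And>i. i \<in> mpoly_vars p \<Longrightarrow> mpoly_vars (g i) \<subseteq> V"
  shows "mpoly_vars (mpoly_ins c g p) \<subseteq> V"
  unfolding mpoly_ins_def
proof (rule mpoly_vars_sum_subset)
  fix m assume m: "m \<in> keys p"
  have "mpoly_vars (\<Prod>i\<in>keys m. g i ^ lookup m i) \<subseteq> V"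
    using m by (intro mpoly_vars_prod_subset mpoly_vars_power_subset assms) (auto simp: mpoly_vars_def)
  with assms(1) show "mpoly_vars (c (lookup p m) * (\<Prod>i\<in>keys m. g i ^ lookup m i)) \<subseteq> V"
    using mpoly_vars_mult by blast
qed

section \<open>Renaming of variables\<close>

lemma unital_ring_hom_mrename: "unital_ring_hom (mrename \<sigma>)"
  unfolding mrename_def by (rule unital_ring_hom_mpoly_ins[OF unital_ring_hom_mConst])

lemma mrename_mVar [simp]: "mrename \<sigma> (mVar i) = mVar (\<sigma> i)"
  by (simp add: mrename_def unital_ring_hom_mConst)

lemma mrename_mConst [simp]: "mrename \<sigma> (mConst a) = mConst a"
  by (simp add: mrename_def unital_ring_hom_mConst)

lemma mpoly_ins_mrename:
  fixes c :: "'a::comm_ring_1 \<Rightarrow> 'b::comm_ring_1"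
  assumes "unital_ring_hom c"
  shows "mpoly_ins c g (mrename \<sigma> p) = mpoly_ins c (\<lambda>i. g (\<sigma> i)) p"
  using unital_ring_hom_mpoly_eq
    [OF unital_ring_hom_comp[OF unital_ring_hom_mpoly_ins[OF assms] unital_ring_hom_mrename], of g \<sigma> p]
  by (simp add: assms)

lemma mrename_mrename: "mrename \<sigma> (mrename \<tau> p) = mrename (\<sigma> \<circ> \<tau>) p"
  unfolding mrename_def[of \<sigma>] mrename_def[of "\<sigma> \<circ> \<tau>"]
  by (simp add: mpoly_ins_mrename unital_ring_hom_mConst)

lemma mrename_id [simp]: "mrename id p = p" "mrename (\<lambda>x. x) p = p"
proof -
  have "p = mpoly_ins mConst mVar p"
    using unital_ring_hom_mpoly_eq[of "\<lambda>x. x :: 'a mpoly" p] by (simp add: unital_ring_hom_def)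
  then show "mrename id p = p" "mrename (\<lambda>x. x) p = p"
    by (simp_all add: mrename_def)
qed

section \<open>Symmetric and elementary symmetric polynomials\<close>

definition msymmetric :: "nat \<Rightarrow> 'a::comm_ring_1 mpoly \<Rightarrow> bool" where
  "msymmetric n p \<longleftrightarrow> (\<forall>\<sigma>. \<sigma> permutes {..<n} \<longrightarrow> mrename \<sigma> p = p)"

lemma msymmetric_diff: "msymmetric n p \<Longrightarrow> msymmetric n q \<Longrightarrow> msymmetric n (p - q)"
  by (simp add: msymmetric_def unital_ring_hom.diff[OF unital_ring_hom_mrename])

lemma msymmetric_mult: "msymmetric n p \<Longrightarrow> msymmetric n q \<Longrightarrow> msymmetric n (p * q)"
  by (simp add: msymmetric_def unital_ring_hom.mult[OF unital_ring_hom_mrename])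

lemma msymmetric_mConst: "msymmetric n (mConst c)"
  by (simp add: msymmetric_def)

lemma msymmetric_mono_eval: "(\<And>i. msymmetric n (g i)) \<Longrightarrow> msymmetric n (mono_eval g m)"
  by (simp add: msymmetric_def mono_eval_def unital_ring_hom.prod[OF unital_ring_hom_mrename]
      unital_ring_hom.power[OF unital_ring_hom_mrename])

lemma finite_subsets_card [simp]: "finite {S. S \<subseteq> {..<n} \<and> card S = (i::nat)}" for n :: nat
  by (rule finite_subset[of _ "Pow {..<n}"]) auto

text \<open>A permutation of the indices permutes the index sets \<open>S\<close> of each fixed
  size.\<close>

lemma msymmetric_esym: "msymmetric n (esym n i :: 'a::comm_ring_1 mpoly)"
  unfolding msymmetric_def
proof (intro allI impI)
  fix \<sigma> :: "nat \<Rightarrow> nat" assume \<sigma>: "\<sigma> permutes {..<n}"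
  let ?A = "{S. S \<subseteq> {..<n} \<and> card S = i}"
  have inj: "inj_on \<sigma> S" for S
    using permutes_inj[OF \<sigma>] by (rule inj_on_subset) simp
  have "bij_betw ((`) \<sigma>) ?A ?A"
  proof (rule bij_betw_byWitness[where f'="(`) (Hilbert_Choice.inv \<sigma>)"])
    show "\<forall>S\<in>?A. Hilbert_Choice.inv \<sigma> ` \<sigma> ` S = S"
      using permutes_inverses(2)[OF \<sigma>] by (force simp: image_image)
    show "\<forall>S\<in>?A. \<sigma> ` Hilbert_Choice.inv \<sigma> ` S = S"
      using permutes_inverses(1)[OF \<sigma>] by (force simp: image_image)
    show "(`) \<sigma> ` ?A \<subseteq> ?A"
      using permutes_in_image[OF \<sigma>] by (auto simp: card_image[OF inj])
    show "(`) (Hilbert_Choice.inv \<sigma>) ` ?A \<subseteq> ?A"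
      using permutes_in_image[OF permutes_inv[OF \<sigma>]]
      by (auto simp: card_image[OF inj_on_subset[OF permutes_inj[OF permutes_inv[OF \<sigma>]]]])
  qed
  then have "esym n i = (\<Sum>S\<in>?A. \<Prod>j\<in>\<sigma> ` S. mVar j :: 'a mpoly)"
    unfolding esym_def by (rule sum.reindex_bij_betw[symmetric])
  also have "\<dots> = mrename \<sigma> (esym n i)"
    by (simp add: esym_def unital_ring_hom.sum[OF unital_ring_hom_mrename]
        unital_ring_hom.prod[OF unital_ring_hom_mrename] prod.reindex[OF inj])
  finally show "mrename \<sigma> (esym n i) = (esym n i :: 'a mpoly)" by (rule sym)
qed

lemma mpoly_vars_esym: "mpoly_vars (esym n i) \<subseteq> {..<n}"
  unfolding esym_def using mpoly_vars_mVar
  by (intro mpoly_vars_sum_subset mpoly_vars_prod_subset) fastforce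

lemma lookup_map_key: "inj f \<Longrightarrow> lookup (Poly_Mapping.map_key f p) k = lookup p (f k)"
  by (simp add: map_key.rep_eq)

lemma lookup_mConst_mult: "lookup (mConst c * p) m = c * lookup p m"
  unfolding mConst_def mult_map_scale_conv_mult[symmetric] by (simp add: Poly_Mapping.map.rep_eq when_def)

text \<open>Renaming by the inverse \<open>\<tau>\<close> of \<open>\<sigma>\<close> carries the
  exponent vector \<open>v\<close> to its composition with \<open>\<sigma>\<close>, so the
  coefficients of a symmetric polynomial are constant on orbits of monomials.\<close>

lemma msymmetric_lookup:
  assumes "msymmetric n p" "\<sigma> permutes {..<n}"
  shows "lookup p (Poly_Mapping.map_key \<sigma> m) = lookup p m"
proof -
  define \<tau> where "\<tau> = Hilbert_Choice.inv \<sigma>"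
  have \<tau>: "\<tau> permutes {..<n}"
    unfolding \<tau>_def by (rule permutes_inv) fact
  have inj: "inj \<sigma>" "inj \<tau>"
    using assms(2) \<tau> by (auto intro: permutes_inj)
  have \<sigma>\<tau>: "\<sigma> (\<tau> x) = x" "\<tau> (\<sigma> x) = x" for x
    unfolding \<tau>_def using permutes_inverses[OF assms(2)] by auto
  have mono: "mono_eval (\<lambda>i. mVar (\<tau> i)) v = Poly_Mapping.single (Poly_Mapping.map_key \<sigma> v) (1::'a)" for v
  proof -
    have k: "keys (Poly_Mapping.map_key \<sigma> v) = \<tau> ` keys v"
      unfolding keys_map_key[OF inj(1)] using \<sigma>\<tau> by (auto simp: image_iff) metis
    have "Poly_Mapping.single (Poly_Mapping.map_key \<sigma> v) (1::'a) = mono_eval mVar (Poly_Mapping.map_key \<sigma> v)"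
      by (simp add: single_eq_mConst_mono_eval unital_ring_hom.one[OF unital_ring_hom_mConst])
    also have "\<dots> = mono_eval (\<lambda>i. mVar (\<tau> i)) v"
      unfolding mono_eval_def k
      by (subst prod.reindex[OF inj_on_subset[OF inj(2)]]) (simp_all add: lookup_map_key inj \<sigma>\<tau>)
    finally show ?thesis ..
  qed
  have inj_key: "Poly_Mapping.map_key \<sigma> v = Poly_Mapping.map_key \<sigma> w \<longleftrightarrow> v = w" for v w :: "nat \<Rightarrow>\<^sub>0 nat"
  proof
    assume eq: "Poly_Mapping.map_key \<sigma> v = Poly_Mapping.map_key \<sigma> w"
    show "v = w"
    proof (rule poly_mapping_eqI)
      fix k
      have "lookup (Poly_Mapping.map_key \<sigma> v) (\<tau> k) = lookup (Poly_Mapping.map_key \<sigma> w) (\<tau> k)"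
        by (simp add: eq)
      then show "lookup v k = lookup w k"
        by (simp add: lookup_map_key inj \<sigma>\<tau>)
    qed
  qed simp
  have "p = mrename \<tau> p"
    using assms(1) \<tau> by (simp add: msymmetric_def)
  also have "\<dots> = (\<Sum>v\<in>keys p. Poly_Mapping.single (Poly_Mapping.map_key \<sigma> v) (lookup p v))"
    unfolding mrename_def mpoly_ins_def mono_eval_def[symmetric] mono
    by (simp add: mConst_def mult_single)
  finally have "lookup p (Poly_Mapping.map_key \<sigma> m) =
      (\<Sum>v\<in>keys p. lookup (Poly_Mapping.single (Poly_Mapping.map_key \<sigma> v) (lookup p v)) (Poly_Mapping.map_key \<sigma> m))"
    by (metis lookup_sum)
  also have "\<dots> = (\<Sum>v\<in>keys p. if v = m then lookup p v else 0)"
    by (intro sum.cong) (simp_all add: lookup_single inj_key when_def)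
  also have "\<dots> = lookup p m"
    by (simp add: in_keys_iff)
  finally show ?thesis .
qed

subsection \<open>Leading monomials\<close>

text \<open>Here \<open>\<le>\<close> is the lexicographic order on exponent vectors in which the
  smallest index decides first, so \<open>u\<close> is the leading exponent.\<close>

definition lead_monic :: "'a::comm_ring_1 mpoly \<Rightarrow> (nat \<Rightarrow>\<^sub>0 nat) \<Rightarrow> bool" where
  "lead_monic p u \<longleftrightarrow> lookup p u = 1 \<and> (\<forall>v\<in>keys p. v \<le> u)"

text \<open>Once the leading terms are split off, every remaining product has a strictly smaller
  exponent, because addition is strictly monotone for the order.\<close>

lemma lead_monic_mult:
  assumes "lead_monic p u" "lead_monic q v"
  shows "lead_monic (p * q) (u + v)"
proof -
  define p' where "p' = p - Poly_Mapping.single u 1"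
  define q' where "q' = q - Poly_Mapping.single v 1"
  have p': "w < u" if "w \<in> keys p'" for w
  proof -
    from that assms(1) have "w \<noteq> u" "w \<in> keys p"
      by (auto simp: p'_def lead_monic_def in_keys_iff lookup_minus lookup_single when_def split: if_splits)
    with assms(1) show ?thesis by (auto simp: lead_monic_def order.strict_iff_order)
  qed
  have q': "w < v" if "w \<in> keys q'" for w
  proof -
    from that assms(2) have "w \<noteq> v" "w \<in> keys q"
      by (auto simp: q'_def lead_monic_def in_keys_iff lookup_minus lookup_single when_def split: if_splits)
    with assms(2) show ?thesis by (auto simp: lead_monic_def order.strict_iff_order)
  qed
  have "p * q = Poly_Mapping.single (u + v) 1 + Poly_Mapping.single u 1 * q' + p' * q"
    by (simp add: p'_def q'_def algebra_simps mult_single)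
  moreover have "lookup (Poly_Mapping.single u 1 * q') (u + v) = 0"
    using keys_mult[of "Poly_Mapping.single u 1" q'] q' by (fastforce simp flip: not_in_keys_iff_lookup_eq_zero)
  moreover have "lookup (p' * q) (u + v) = 0"
  proof (rule ccontr)
    assume "lookup (p' * q) (u + v) \<noteq> 0"
    then obtain a b where "u + v = a + b" "a \<in> keys p'" "b \<in> keys q"
      using keys_mult[of p' q] by (auto simp: in_keys_iff)
    with p' assms(2) have "a + b < u + v"
      by (intro add_less_le_mono) (auto simp: lead_monic_def)
    with \<open>u + v = a + b\<close> show False by simp
  qed
  ultimately have "lookup (p * q) (u + v) = 1"
    by (simp add: lookup_add)
  moreover have "w \<le> u + v" if "w \<in> keys (p * q)" for w
    using that keys_mult[of p q] assms by (fastforce simp: lead_monic_def intro: add_mono)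
  ultimately show ?thesis by (simp add: lead_monic_def)
qed

lemma lead_monic_1: "lead_monic 1 0"
  by (simp add: lead_monic_def)

lemma lead_monic_prod:
  assumes "\<And>x. x \<in> A \<Longrightarrow> lead_monic (f x) (g x)"
  shows "lead_monic (prod f A) (sum g A)"
  using assms
  by (induction A rule: infinite_finite_induct)
     (auto intro: lead_monic_mult simp: lead_monic_1)

text \<open>The exponent vector of the squarefree monomial in the variables indexed by
  \<open>S\<close>.\<close>

definition set_mono :: "nat set \<Rightarrow> (nat \<Rightarrow>\<^sub>0 nat)" where
  "set_mono S = (\<Sum>i\<in>S. Poly_Mapping.single i 1)"

lemma lookup_set_mono: "finite S \<Longrightarrow> lookup (set_mono S) j = (if j \<in> S then 1 else 0)"
  by (auto simp: set_mono_def lookup_sum lookup_single when_def)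

lemma lead_monic_esym:
  assumes "k \<le> n"
  shows "lead_monic (esym n k :: 'a::comm_ring_1 mpoly) (set_mono {..<k})"
proof -
  let ?A = "{S. S \<subseteq> {..<n} \<and> card S = k}"
  have mono: "(\<Prod>j\<in>S. mVar j) = (Poly_Mapping.single (set_mono S) 1 :: 'a mpoly)" for S
    unfolding set_mono_def mVar_def by (induction S rule: infinite_finite_induct) (simp_all add: mult_single)
  have less: "set_mono S < set_mono {..<k}" if S: "S \<in> ?A" "S \<noteq> {..<k}" for S
  proof -
    from S have fin: "finite S" by (auto intro: finite_subset)
    have "\<not> {..<k} \<subseteq> S"
    proof
      assume "{..<k} \<subseteq> S"
      with fin S(1) have "{..<k} = S" by (intro card_subset_eq) simp_all
      with S(2) show False by simp
    qed
    then have ex: "\<exists>j. j < k \<and> j \<notin> S" by auto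
    \<comment> \<open>At the least index below \<open>k\<close> that is missing from
      \<open>S\<close> the two exponent vectors first differ, and \<open>{..<k}\<close> has the
      larger entry there.\<close>
    define j where "j = (LEAST j. j < k \<and> j \<notin> S)"
    have j: "j < k" "j \<notin> S" "\<And>i. i < j \<Longrightarrow> i < k \<longrightarrow> i \<in> S"
      using LeastI_ex[OF ex, folded j_def] not_less_Least[of _ "\<lambda>j. j < k \<and> j \<notin> S", folded j_def] by blast+
    have "less_fun (lookup (set_mono S)) (lookup (set_mono {..<k}))"
      unfolding less_fun_def using j fin by (intro exI[of _ j]) (auto simp: lookup_set_mono)
    then show ?thesis by (simp add: less_poly_mapping.rep_eq)
  qed
  have "lookup (esym n k) (set_mono {..<k}) = (\<Sum>S\<in>?A. if S = {..<k} then 1 else 0 :: 'a)"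
    unfolding esym_def lookup_sum mono
  proof (rule sum.cong)
    fix S assume "S \<in> ?A"
    with less[of S] have "set_mono S = set_mono {..<k} \<longleftrightarrow> S = {..<k}" by (metis less_irrefl)
    then show "lookup (Poly_Mapping.single (set_mono S) 1) (set_mono {..<k}) = (if S = {..<k} then 1 else 0 :: 'a)"
      by (simp add: lookup_single when_def)
  qed simp
  also have "\<dots> = 1" using assms by simp
  finally have "lookup (esym n k) (set_mono {..<k}) = (1::'a)" .
  moreover have "v \<le> set_mono {..<k}" if "v \<in> keys (esym n k :: 'a mpoly)" for v
  proof -
    from that keys_sum[of "\<lambda>S. Poly_Mapping.single (set_mono S) (1::'a)" ?A]
    obtain S where "S \<in> ?A" "v = set_mono S" by (auto simp: esym_def mono)
    with less[of S] show ?thesis by (cases "S = {..<k}") auto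
  qed
  ultimately show ?thesis by (simp add: lead_monic_def)
qed

text \<open>The leading exponent of the product of the \<open>esym n i\<close> to the powers
  \<open>lookup m i\<close>: each factor contributes the leading exponent
  \<open>set_mono {..<i}\<close> of \<open>esym n i\<close>.\<close>

definition esym_lead :: "(nat \<Rightarrow>\<^sub>0 nat) \<Rightarrow> (nat \<Rightarrow>\<^sub>0 nat)" where
  "esym_lead m = (\<Sum>i\<in>keys m. \<Sum>_<lookup m i. set_mono {..<i})"

lemma lead_monic_mono_eval_esym:
  assumes "keys m \<subseteq> {1..n}"
  shows "lead_monic (mono_eval (esym n) m) (esym_lead m)"
  unfolding mono_eval_def esym_lead_def
proof (rule lead_monic_prod)
  fix i assume "i \<in> keys m"
  with assms have "i \<le> n" by auto
  then have "lead_monic (\<Prod>_<lookup m i. esym n i) (\<Sum>_<lookup m i. set_mono {..<i})"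
    by (intro lead_monic_prod lead_monic_esym)
  then show "lead_monic (esym n i ^ lookup m i) (\<Sum>_<lookup m i. set_mono {..<i})" by simp
qed

text \<open>Variable \<open>j\<close> occurs in the leading monomial of \<open>esym n i\<close>
  exactly when \<open>j < i\<close>, which makes the entries tail sums of \<open>m\<close>.\<close>

lemma lookup_esym_lead:
  assumes "keys m \<subseteq> {1..n}"
  shows "lookup (esym_lead m) j = (\<Sum>i\<in>{j<..n}. lookup m i)"
proof -
  have "lookup (esym_lead m) j = (\<Sum>i\<in>keys m. if j < i then lookup m i else 0)"
    unfolding esym_lead_def lookup_sum by (rule sum.cong) (auto simp: lookup_set_mono)
  also have "\<dots> = (\<Sum>i\<in>keys m \<inter> {j<..n}. lookup m i)"
    using assms by (intro sum.mono_neutral_cong_right) auto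
  also have "\<dots> = (\<Sum>i\<in>{j<..n}. lookup m i)"
    by (rule sum.mono_neutral_left) (auto simp: in_keys_iff)
  finally show ?thesis .
qed

text \<open>The differences of consecutive tail sums recover the exponents.\<close>

lemma esym_lead_inj:
  assumes "keys m \<subseteq> {1..n}" "keys m' \<subseteq> {1..n}" "esym_lead m = esym_lead m'"
  shows "m = m'"
proof (rule poly_mapping_eqI)
  fix k
  show "lookup m k = lookup m' k"
  proof (cases "k \<in> {1..n}")
    case True
    then obtain j where j: "k = Suc j" "j < n" by (cases k) auto
    have "{j<..n} = insert k {k<..n}" using j by auto
    then have "lookup (esym_lead v) j = lookup v k + lookup (esym_lead v) k" if "keys v \<subseteq> {1..n}" for v
      by (simp add: lookup_esym_lead[OF that])
    with assms show ?thesis by (metis add_right_cancel)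
  next
    case False
    with assms have "k \<notin> keys m" "k \<notin> keys m'" by blast+
    then show ?thesis by (simp add: in_keys_iff)
  qed
qed

text \<open>Distinct monomials in the elementary symmetric polynomials have distinct leading
  exponents, so the term with the largest one cannot be cancelled.\<close>

theorem esym_algebraically_independent:
  fixes p :: "'a::comm_ring_1 mpoly"
  assumes "mpoly_vars p \<subseteq> {1..n}" "mpoly_ins mConst (esym n) p = 0"
  shows "p = 0"
proof (rule ccontr)
  assume "p \<noteq> 0"
  then have ne: "keys p \<noteq> {}" by simp
  have keys: "keys m \<subseteq> {1..n}" if "m \<in> keys p" for m
    using that assms(1) by (auto simp: mpoly_vars_def)
  define u where "u = Max (esym_lead ` keys p)"
  have "u \<in> esym_lead ` keys p"
    unfolding u_def using ne by (intro Max_in) auto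
  then obtain m where m: "m \<in> keys p" "u = esym_lead m" by auto
  have u_max: "esym_lead v \<le> u" if "v \<in> keys p" for v
    unfolding u_def using that by simp
  have lk: "lookup (mono_eval (esym n) v) u = (if v = m then 1 else 0 :: 'a)" if "v \<in> keys p" for v
  proof (cases "v = m")
    case True
    then show ?thesis
      using lead_monic_mono_eval_esym[OF keys[OF m(1)]] m by (auto simp: lead_monic_def)
  next
    case False
    with u_max[OF that] keys esym_lead_inj m that have "esym_lead v < u"
      by (metis order.not_eq_order_implies_strict)
    with lead_monic_mono_eval_esym[OF keys[OF that], where 'a='a] False show ?thesis
      by (force simp: lead_monic_def in_keys_iff)
  qed
  have lc: "lookup (mConst c * q) u = c * lookup q u" for c :: 'a and q
    by (rule lookup_mConst_mult)
  have "0 = lookup (mpoly_ins mConst (esym n) p) u"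
    by (simp add: assms)
  also have "\<dots> = (\<Sum>v\<in>keys p. lookup p v * lookup (mono_eval (esym n) v) u)"
    by (simp add: mpoly_ins_def lookup_sum lc mono_eval_def)
  also have "\<dots> = (\<Sum>v\<in>keys p. if v = m then lookup p v else 0)"
    by (rule sum.cong) (simp_all add: lk)
  also have "\<dots> = lookup p m" using m by simp
  finally show False using m by (simp add: in_keys_iff)
qed

text \<open>With infinitely many variables the lexicographic order has infinite descents such as X_0
  > X_1 > X_2 > ..., so the variables are bounded and exponent vectors are compared as tuples of
  length \<open>n\<close>.\<close>

lemma wf_lex_bounded_vars:
  "wf {(a, b :: nat \<Rightarrow>\<^sub>0 nat). a < b \<and> keys a \<subseteq> {..<n} \<and> keys b \<subseteq> {..<n}}"
proof (rule wf_subset[OF wf_inv_image[OF wf_lexn[OF wf_less_than]]])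
  show "{(a, b :: nat \<Rightarrow>\<^sub>0 nat). a < b \<and> keys a \<subseteq> {..<n} \<and> keys b \<subseteq> {..<n}}
     \<subseteq> inv_image (lexn less_than n) (\<lambda>m. map (lookup m) [0..<n])"
  proof clarify
    fix a b :: "nat \<Rightarrow>\<^sub>0 nat"
    assume ab: "a < b" "keys a \<subseteq> {..<n}" "keys b \<subseteq> {..<n}"
    from ab(1) obtain k where k: "lookup a k < lookup b k" "\<And>i. i < k \<Longrightarrow> lookup a i = lookup b i"
      unfolding less_poly_mapping.rep_eq by (auto elim: less_funE)
    from k(1) have "k \<in> keys b" by (auto simp: in_keys_iff)
    with ab have "k < n" by auto
    then have "[0..<n] = [0..<k] @ k # [Suc k..<n]"
      by (metis upt_add_eq_append upt_conv_Cons less_imp_le_nat le_add_diff_inverse zero_le)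
    then have split: "map (lookup v) [0..<n] = map (lookup v) [0..<k] @ lookup v k # map (lookup v) [Suc k..<n]" for v :: "nat \<Rightarrow>\<^sub>0 nat"
      by simp
    have pre: "map (lookup a) [0..<k] = map (lookup b) [0..<k]"
      using k by simp
    show "(a, b) \<in> inv_image (lexn less_than n) (\<lambda>m. map (lookup m) [0..<n])"
      unfolding in_inv_image lexn_conv
      using k(1) \<open>k < n\<close> split[of a] split[of b, folded pre] by (auto intro!: exI)
  qed
qed

text \<open>Existence half of the fundamental theorem of symmetric polynomials, by Gauss's
  algorithm: cancel the leading term with a product of elementary symmetric polynomials and recurse
  on the smaller leading exponent.\<close>

theorem msymmetric_eq_esym_poly:
  fixes f :: "'a::comm_ring_1 mpoly"
  assumes "msymmetric n f" "mpoly_vars f \<subseteq> {..<n}"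
  shows "\<exists>p. mpoly_vars p \<subseteq> {1..n} \<and> mpoly_ins mConst (esym n) p = f"
proof -
  interpret ins: unital_ring_hom "mpoly_ins mConst (esym n :: nat \<Rightarrow> 'a mpoly)"
    by (rule unital_ring_hom_mpoly_ins[OF unital_ring_hom_mConst])
  have step: "\<exists>p. mpoly_vars p \<subseteq> {1..n} \<and> mpoly_ins mConst (esym n) p = f"
    if "msymmetric n f" "mpoly_vars f \<subseteq> {..<n}" "f \<noteq> 0" "u = Max (keys f)" for u and f :: "'a mpoly"
    using wf_lex_bounded_vars[of n] that
  proof (induction u arbitrary: f rule: wf_induct_rule)
    case (less u)
    have u: "u \<in> keys f" "\<And>v. v \<in> keys f \<Longrightarrow> v \<le> u"
      using less.prems by auto
    then have ku: "keys u \<subseteq> {..<n}"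
      using less.prems(2) by (auto simp: mpoly_vars_def)
    \<comment> \<open>If an exponent increased, then by symmetry the swap of the two neighbouring
      variables would produce a larger monomial of \<open>f\<close>.\<close>
    have dec: "lookup u (Suc i) \<le> lookup u i" if "Suc i < n" for i
    proof (rule ccontr)
      assume contra: "\<not> ?thesis"
      define \<sigma> where "\<sigma> = transpose i (Suc i)"
      have \<sigma>: "\<sigma> permutes {..<n}"
        unfolding \<sigma>_def using that by (intro permutes_swap_id) auto
      have inj: "inj \<sigma>" using \<sigma> by (rule permutes_inj)
      have \<sigma>_app: "\<sigma> i = Suc i" "\<And>k. k < i \<Longrightarrow> \<sigma> k = k"
        by (simp_all add: \<sigma>_def transpose_def)
      have "Poly_Mapping.map_key \<sigma> u \<in> keys f"
        using msymmetric_lookup[OF less.prems(1) \<sigma>] u(1) by (simp add: in_keys_iff)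
      then have "Poly_Mapping.map_key \<sigma> u \<le> u" by (rule u(2))
      moreover have "less_fun (lookup u) (lookup (Poly_Mapping.map_key \<sigma> u))"
        unfolding less_fun_def using contra by (intro exI[of _ i]) (auto simp: lookup_map_key[OF inj] \<sigma>_app)
      then have "u < Poly_Mapping.map_key \<sigma> u"
        by (simp add: less_poly_mapping.rep_eq)
      ultimately show False by simp
    qed
    \<comment> \<open>The exponents of \<open>m\<close> are the drops of \<open>u\<close>, so their
      tail sums telescope back to \<open>u\<close>. By \<open>dec\<close> the truncated subtraction
      loses nothing.\<close>
    define m where "m = (\<Sum>i\<in>{1..n}. Poly_Mapping.single i (lookup u (i - 1) - lookup u i))"
    have lm: "lookup m i = (if i \<in> {1..n} then lookup u (i - 1) - lookup u i else 0)" for i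
      by (auto simp: m_def lookup_sum lookup_single when_def)
    have km: "keys m \<subseteq> {1..n}" by (auto simp: in_keys_iff lm split: if_splits)
    have un: "lookup u j = 0" if "n \<le> j" for j
      using ku that by (force simp: in_keys_iff)
    have "lookup (esym_lead m) j = lookup u j" for j
    proof (cases "j < n")
      case True
      have "(\<Sum>i\<in>{j<..n}. lookup m i) = lookup u j" if "j \<le> n" for j
        using that
      proof (induction j rule: inc_induct)
        case (step j)
        have "{j<..n} = insert (Suc j) {Suc j<..n}" using step by auto
        moreover have "lookup u (Suc j) \<le> lookup u j"
          using dec[of j] un[of "Suc j"] by (cases "Suc j < n") auto
        ultimately show ?case using step by (simp add: lm)
      qed (simp add: un)
      with True show ?thesis by (simp add: lookup_esym_lead[OF km])
    qed (simp add: lookup_esym_lead[OF km] un)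
    then have lead: "esym_lead m = u" by (intro poly_mapping_eqI)
    define M where "M = (mono_eval (esym n) m :: 'a mpoly)"
    have M: "lookup M u = 1" "\<And>v. v \<in> keys M \<Longrightarrow> v \<le> u"
      using lead_monic_mono_eval_esym[OF km, where 'a='a] by (auto simp: lead M_def lead_monic_def)
    define c where "c = lookup f u"
    define f' where "f' = f - mConst c * M"
    have lc: "lookup (mConst c * M) v = c * lookup M v" for v
      by (rule lookup_mConst_mult)
    have lf': "lookup f' v = lookup f v - c * lookup M v" for v
      by (simp add: f'_def lookup_minus lc)
    have f'_less: "v < u" if "v \<in> keys f'" for v
    proof -
      have "v \<in> keys f \<or> v \<in> keys M"
        using that by (auto simp: in_keys_iff lf')
      then have "v \<le> u" using u M by auto
      moreover have "v \<noteq> u" using that M by (auto simp: in_keys_iff lf' c_def)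
      ultimately show ?thesis by simp
    qed
    have varsM: "mpoly_vars M \<subseteq> {..<n}"
      unfolding M_def mono_eval_def
      by (intro mpoly_vars_prod_subset mpoly_vars_power_subset mpoly_vars_esym)
    have vars': "mpoly_vars f' \<subseteq> {..<n}"
      unfolding f'_def diff_conv_add_uminus
      using mpoly_vars_add mpoly_vars_mult[of "mConst c" M] varsM less.prems(2)
      by (fastforce simp: mpoly_vars_uminus mpoly_vars_mConst)
    have sym': "msymmetric n f'"
      unfolding f'_def M_def
      by (intro msymmetric_diff msymmetric_mult msymmetric_mConst msymmetric_mono_eval msymmetric_esym less.prems)
    have "\<exists>p. mpoly_vars p \<subseteq> {1..n} \<and> mpoly_ins mConst (esym n) p = f'"
    proof (cases "f' = 0")
      case True
      then show ?thesis by (intro exI[of _ 0]) (simp add: mpoly_vars_def)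
    next
      case False
      then have max: "Max (keys f') \<in> keys f'" by (intro Max_in) auto
      then have "keys (Max (keys f')) \<subseteq> {..<n}"
        using vars' by (auto simp: mpoly_vars_def)
      with False f'_less[OF max] ku show ?thesis
        by (intro less.IH[OF _ sym' vars' False refl]) auto
    qed
    then obtain p where p: "mpoly_vars p \<subseteq> {1..n}" "mpoly_ins mConst (esym n) p = f'" by auto
    have "mpoly_ins mConst (esym n) (p + Poly_Mapping.single m c) = f"
      using p(2) by (simp add: ins.add mpoly_ins_single unital_ring_hom.zero[OF unital_ring_hom_mConst] f'_def M_def)
    moreover have "mpoly_vars (p + Poly_Mapping.single m c) \<subseteq> {1..n}"
    proof -
      have "mpoly_vars (Poly_Mapping.single m c) \<subseteq> keys m"
        by (auto simp: mpoly_vars_def)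
      with mpoly_vars_add[of p "Poly_Mapping.single m c"] p(1) km show ?thesis by blast
    qed
    ultimately show ?case by blast
  qed
  show ?thesis
  proof (cases "f = 0")
    case True
    then show ?thesis by (intro exI[of _ 0]) (simp add: mpoly_vars_def)
  qed (use step assms in blast)
qed

section \<open>Specialising the ring generated by a root of unity\<close>

lemma unital_ring_hom_map_poly:
  assumes "unital_ring_hom c"
  shows "unital_ring_hom (map_poly c)"
proof -
  interpret c: unital_ring_hom c by fact
  show ?thesis
    by standard (simp_all add: poly_eq_iff coeff_map_poly coeff_mult c.add c.mult c.sum)
qed

lemma unital_ring_hom_poly: "unital_ring_hom (\<lambda>p. poly p (z :: 'a::comm_ring_1))"
  by standard simp_all

text \<open>The image is the ring generated by \<open>z\<close> over the integers. That every
  \<open>p\<close> vanishing at \<open>z\<close> also vanishes at \<open>\<omega>\<close> thus says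
  that \<open>z \<mapsto> \<omega>\<close> defines a homomorphism on this ring, without a type for
  the ring itself.\<close>

definition int_eval :: "'a::comm_ring_1 \<Rightarrow> int poly \<Rightarrow> 'a" where
  "int_eval z p = poly (map_poly of_int p) z"

lemma unital_ring_hom_int_eval: "unital_ring_hom (int_eval z)"
  unfolding int_eval_def
  by (rule unital_ring_hom_comp[OF unital_ring_hom_poly unital_ring_hom_map_poly[OF unital_ring_hom_of_int]])

interpretation int_eval: unital_ring_hom "int_eval z" for z :: "'a::comm_ring_1"
  by (rule unital_ring_hom_int_eval)

lemma int_eval_const [simp]: "int_eval z [:k:] = of_int k"
  by (simp add: int_eval_def map_poly_pCons)

lemma int_eval_monom [simp]: "int_eval z (Polynomial.monom k n) = of_int k * z ^ n"
  by (simp add: int_eval_def map_poly_monom poly_monom)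

lemma int_eval_smult: "int_eval z (smult k p) = of_int k * int_eval z p"
  using int_eval.mult[of z "[:k:]" p] by simp

lemma int_eval_altdef: "int_eval z p = (\<Sum>t\<le>Polynomial.degree p. of_int (coeff p t) * z ^ t)"
  by (subst poly_as_sum_of_monoms[symmetric]) (simp only: int_eval.sum int_eval_monom)

text \<open>The primitive part of an integer polynomial of least degree vanishing at
  \<open>z\<close> divides \<open>X^m - 1\<close> up to a scalar; Gauss's lemma on contents then
  makes its leading coefficient a unit.\<close>

lemma root_of_unity_min_poly:
  fixes z :: complex
  assumes "z ^ m = 1" "m \<ge> 1"
  obtains \<mu> :: "int poly" where "lead_coeff \<mu> = 1" "Polynomial.degree \<mu> > 0" "int_eval z \<mu> = 0"
    "\<And>p. int_eval z p = 0 \<Longrightarrow> Polynomial.degree p < Polynomial.degree \<mu> \<Longrightarrow> p = 0"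
proof -
  define P where "P = Polynomial.monom (1::int) m - 1"
  have P0: "int_eval z P = 0"
    by (simp add: P_def int_eval.diff assms)
  have Pm: "coeff P m = 1" using assms(2) by (simp add: P_def)
  have "Polynomial.degree P \<le> m"
    unfolding P_def by (rule degree_diff_le) (simp_all add: degree_monom_le)
  with Pm have lcP: "lead_coeff P = 1"
    by (metis le_antisym le_degree zero_neq_one)
  then have "P \<noteq> 0" by auto
  define Q where "Q = (\<lambda>p. p \<noteq> 0 \<and> int_eval z p = 0)"
  define g0 where "g0 = arg_min Polynomial.degree Q"
  have "Q P" using P0 \<open>P \<noteq> 0\<close> by (simp add: Q_def)
  then have g0: "Q g0" "\<And>p. Q p \<Longrightarrow> Polynomial.degree g0 \<le> Polynomial.degree p"
    unfolding g0_def using arg_min_nat_lemma[of Q P Polynomial.degree] by auto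
  define g where "g = primitive_part g0"
  have [simp]: "g0 \<noteq> 0" using g0 by (simp add: Q_def)
  have [simp]: "g \<noteq> 0" by (simp add: g_def)
  have deg: "Polynomial.degree g = Polynomial.degree g0" by (simp add: g_def)
  have "of_int (content g0) * int_eval z g = int_eval z (smult (content g0) g)"
    by (simp only: int_eval_smult)
  also have "\<dots> = 0" using g0(1) by (simp add: g_def Q_def)
  finally have gz: "int_eval z g = 0" by simp
  have min: "p = 0" if "int_eval z p = 0" "Polynomial.degree p < Polynomial.degree g" for p
    using g0(2)[of p] that by (auto simp: Q_def deg)
  \<comment> \<open>Division over the integers costs a factor \<open>a\<close>; the remainder
    vanishes at \<open>z\<close> and is therefore 0 by minimality.\<close>
  obtain a q where aq: "a \<noteq> 0" "smult a P = g * q + pseudo_mod P g"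
    using pseudo_mod(1)[OF \<open>g \<noteq> 0\<close>, of P] by auto
  have "int_eval z (smult a P) = int_eval z (g * q + pseudo_mod P g)" by (simp add: aq)
  then have "int_eval z (pseudo_mod P g) = 0"
    by (simp add: int_eval_smult int_eval.add int_eval.mult P0 gz)
  with pseudo_mod(2)[OF \<open>g \<noteq> 0\<close>, of P] have "pseudo_mod P g = 0"
    using min by blast
  with aq have eq: "smult a P = g * q" by simp
  \<comment> \<open>\<open>P\<close> and \<open>g\<close> are primitive, so the content of
    \<open>q\<close> is \<open>a\<close> up to sign. Hence \<open>a\<close> cancels from the leading
    coefficients and \<open>lead_coeff g\<close> divides 1.\<close>
  have "content P dvd 1" using content_dvd_coeff[of P m] Pm by simp
  then have cP: "content P = 1" by (rule is_unit_content_iff[THEN iffD1])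
  have "normalize a = content g * content q"
    using arg_cong[OF eq, of content] cP by (simp add: content_mult)
  then have "content q = normalize a" by (simp add: g_def)
  then have "a dvd lead_coeff q"
    using content_dvd_coeff[of q "Polynomial.degree q"] by simp
  then obtain x where x: "lead_coeff q = a * x" by auto
  have "a = lead_coeff g * lead_coeff q"
    using arg_cong[OF eq, of lead_coeff] lcP aq(1) by (simp add: lead_coeff_mult)
  with x aq(1) have "lead_coeff g * x = 1" by simp
  then have lg: "lead_coeff g * lead_coeff g = 1"
    by (auto simp: zmult_eq_1_iff)
  \<comment> \<open>A unit of the integers is its own inverse, so scaling \<open>g\<close> by its
    leading coefficient makes it monic.\<close>
  show ?thesis
  proof (rule that[of "smult (lead_coeff g) g"])
    have deg': "Polynomial.degree (smult (lead_coeff g) g) = Polynomial.degree g" by simp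
    show "lead_coeff (smult (lead_coeff g) g) = 1" using lg by (simp add: lead_coeff_smult)
    show "int_eval z (smult (lead_coeff g) g) = 0" by (simp add: int_eval_smult gz)
    show "p = 0" if "int_eval z p = 0" "Polynomial.degree p < Polynomial.degree (smult (lead_coeff g) g)" for p
      using that min deg' by simp
    show "Polynomial.degree (smult (lead_coeff g) g) > 0"
    proof (rule ccontr)
      assume "\<not> ?thesis"
      then have "Polynomial.degree g = 0" by simp
      then obtain k where "g = [:k:]" by (rule degree_eq_zeroE)
      with gz \<open>g \<noteq> 0\<close> show False by simp
    qed
  qed
qed

lemma monic_division:
  fixes p \<mu> :: "int poly"
  assumes "lead_coeff \<mu> = 1"
  obtains q r where "p = \<mu> * q + r" "r = 0 \<or> Polynomial.degree r < Polynomial.degree \<mu>"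
proof -
  obtain q r where qr: "pseudo_divmod p \<mu> = (q, r)" by force
  have "\<mu> \<noteq> 0" using assms by auto
  from pseudo_divmod[OF this qr] assms show ?thesis by (intro that[of q r]) auto
qed

text \<open>For a field of positive characteristic this is reduction modulo a prime above the
  characteristic: a root of the minimal polynomial receives a homomorphism from \<open>\<int>[z]\<close>.\<close>

lemma root_of_unity_specialization:
  fixes z :: complex
  assumes "z ^ m = 1" "m \<ge> 1"
  obtains \<omega> :: "'k::alg_closed_field" where "\<And>p. int_eval z p = 0 \<Longrightarrow> int_eval \<omega> p = 0"
proof -
  obtain \<mu> where \<mu>: "lead_coeff \<mu> = 1" "Polynomial.degree \<mu> > 0" "int_eval z \<mu> = 0"
    "\<And>p. int_eval z p = 0 \<Longrightarrow> Polynomial.degree p < Polynomial.degree \<mu> \<Longrightarrow> p = 0"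
    using root_of_unity_min_poly[OF assms] by blast
  \<comment> \<open>Being monic, \<open>\<mu>\<close> keeps a positive degree over a field of any
    characteristic, so it has a root there.\<close>
  have "coeff (map_poly of_int \<mu> :: 'k poly) (Polynomial.degree \<mu>) = 1"
    using \<mu>(1) by (simp add: coeff_map_poly)
  then have "Polynomial.degree (map_poly of_int \<mu> :: 'k poly) > 0"
    using \<mu>(2) le_degree[of "map_poly of_int \<mu> :: 'k poly" "Polynomial.degree \<mu>"] by simp
  then obtain \<omega> :: 'k where \<omega>: "int_eval \<omega> \<mu> = 0"
    unfolding int_eval_def using alg_closed_imp_poly_has_root by blast
  show ?thesis
  proof (rule that)
    fix p assume p: "int_eval z p = 0"
    obtain q r where qr: "p = \<mu> * q + r" "r = 0 \<or> Polynomial.degree r < Polynomial.degree \<mu>"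
      using monic_division[OF \<mu>(1)] .
    have "int_eval z r = 0" using p qr \<mu>(3) by (simp add: int_eval.add int_eval.mult)
    with \<mu>(4) qr(2) have "r = 0" by blast
    with qr \<omega> show "int_eval \<omega> p = 0" by (simp add: int_eval.mult)
  qed
qed

text \<open>The powers of \<open>z\<close> below the degree of its minimal polynomial are
  independent over the integers, so a rational element of the ring generated by \<open>z\<close> is
  an integer.\<close>

lemma int_eval_root_of_unity_integer:
  fixes z :: complex and M N :: int
  assumes "z ^ m = 1" "m \<ge> 1" "N \<noteq> 0" "of_int N * int_eval z p = of_int M"
  shows "int_eval z p \<in> \<int>"
proof -
  obtain \<mu> where \<mu>: "lead_coeff \<mu> = 1" "Polynomial.degree \<mu> > 0" "int_eval z \<mu> = 0"
    "\<And>p. int_eval z p = 0 \<Longrightarrow> Polynomial.degree p < Polynomial.degree \<mu> \<Longrightarrow> p = 0"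
    using root_of_unity_min_poly[OF assms(1,2)] by blast
  obtain q r where qr: "p = \<mu> * q + r" "r = 0 \<or> Polynomial.degree r < Polynomial.degree \<mu>"
    using monic_division[OF \<mu>(1)] .
  have pr: "int_eval z p = int_eval z r"
    by (simp add: qr int_eval.add int_eval.mult \<mu>)
  \<comment> \<open>Below the degree of \<open>\<mu>\<close> an equation between values at
    \<open>z\<close> is already an equation between polynomials.\<close>
  have "Polynomial.degree (smult N r - [:M:]) < Polynomial.degree \<mu>"
    using qr(2) \<mu>(2) by (intro degree_diff_less) auto
  moreover have "int_eval z (smult N r - [:M:]) = 0"
    using assms(4) by (simp add: int_eval.diff int_eval_smult pr)
  ultimately have "smult N r = [:M:]" using \<mu>(4) by fastforce
  then have "Polynomial.degree (smult N r) = 0" by simp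
  with assms(3) have "Polynomial.degree r = 0" by simp
  then obtain k where "r = [:k:]" by (rule degree_eq_zeroE)
  then show ?thesis by (simp add: pr)
qed

text \<open>Both sides have degree at most \<open>n\<close>, share the coefficient at
  \<open>n\<close>, and agree at \<open>n\<close> distinct points.\<close>

lemma monic_eq_prod_roots:
  fixes p :: "'a::idom poly"
  assumes "lead_coeff p = 1" "Polynomial.degree p = n" "inj_on u {..<n}" "\<And>i. i < n \<Longrightarrow> poly p (u i) = 0"
  shows "p = (\<Prod>i<n. [:- u i, 1:])"
proof (rule poly_eqI_degree_lead_coeff[where A="u ` {..<n}" and n=n])
  have deg: "Polynomial.degree (\<Prod>i<n. [:- u i, 1:]) = n"
    by (subst degree_prod_sum_eq) simp_all
  then show "Polynomial.degree (\<Prod>i<n. [:- u i, 1:]) \<le> n" by simp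
  have "lead_coeff (\<Prod>i<n. [:- u i, 1:]) = 1"
    by (simp add: lead_coeff_prod)
  with deg assms show "coeff p n = coeff (\<Prod>i<n. [:- u i, 1:]) n" by simp
  show "card (u ` {..<n}) \<ge> n" using assms by (simp add: card_image)
  show "Polynomial.degree p \<le> n" using assms by simp
  fix x assume "x \<in> u ` {..<n}"
  then show "poly p x = poly (\<Prod>i<n. [:- u i, 1:]) x"
    using assms(4) by (force simp: poly_prod)
qed

section \<open>Complex roots of unity and their images in other fields\<close>

definition zeta :: "nat \<Rightarrow> complex" where "zeta m = cis (2 * pi / real m)"

lemma zeta_pow: "zeta m ^ k = cis (2 * pi * real k / real m)"
  by (simp add: zeta_def DeMoivre mult_ac)

lemma zeta_pow_self: "m \<ge> 1 \<Longrightarrow> zeta m ^ m = 1"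
  by (simp add: zeta_pow)

lemma zeta_pow_mod: "m \<ge> 1 \<Longrightarrow> zeta m ^ (k mod m) = zeta m ^ k"
proof -
  assume m: "m \<ge> 1"
  have "zeta m ^ k = zeta m ^ (m * (k div m) + k mod m)" by simp
  also have "\<dots> = zeta m ^ (k mod m)"
    unfolding power_add power_mult zeta_pow_self[OF m] by simp
  finally show ?thesis by simp
qed

lemma specialization_roots_of_unity:
  fixes \<omega> \<epsilon> :: "'k::field"
  assumes m: "m \<ge> 1" and sp: "\<And>p. int_eval (zeta m) p = 0 \<Longrightarrow> int_eval \<omega> p = 0" and \<epsilon>: "\<epsilon> ^ m = 1"
  shows "\<exists>k<m. \<epsilon> = \<omega> ^ k"
proof -
  \<comment> \<open>\<open>D\<close> is the difference of the two sides of the factorisation of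
    \<open>X^m - 1\<close>, with the indeterminate of the coefficient ring in place of the root of
    unity. Its coefficients vanish at \<open>zeta m\<close>, hence at
    \<open>\<omega>\<close>.\<close>
  define D where "D = Polynomial.monom 1 m - 1 - (\<Prod>i<m. [: - Polynomial.monom 1 i, 1 :] :: int poly poly)"
  have D: "map_poly (int_eval z) D = Polynomial.monom 1 m - 1 - (\<Prod>i<m. [: - (z ^ i), 1 :])"
    for z :: "'c::comm_ring_1"
  proof -
    interpret H: unital_ring_hom "map_poly (int_eval z)"
      by (rule unital_ring_hom_map_poly[OF unital_ring_hom_int_eval])
    show ?thesis
      by (simp add: D_def H.diff H.prod map_poly_monom map_poly_pCons int_eval.uminus)
  qed
  have "Polynomial.monom 1 m - 1 = (\<Prod>i<m. [:- (zeta m ^ i), 1:])"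
  proof (rule monic_eq_prod_roots)
    have deg_le: "Polynomial.degree (Polynomial.monom 1 m - 1 :: complex poly) \<le> m"
      by (rule degree_diff_le) (simp_all add: degree_monom_le)
    have co: "coeff (Polynomial.monom 1 m - 1 :: complex poly) m = 1" using m by simp
    with deg_le show deg: "Polynomial.degree (Polynomial.monom 1 m - 1 :: complex poly) = m"
      by (metis le_antisym le_degree zero_neq_one)
    show "lead_coeff (Polynomial.monom 1 m - 1 :: complex poly) = 1" unfolding deg by (rule co)
    show "inj_on ((^) (zeta m)) {..<m}"
      using bij_betw_roots_unity[of m] m by (simp add: bij_betw_def inj_on_def zeta_pow)
    show "poly (Polynomial.monom 1 m - 1) (zeta m ^ i) = 0" for i
      using zeta_pow_self[OF m] by (simp add: poly_monom mult.commute[of i] power_mult flip: power_mult)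
        (metis mult.commute power_mult power_one)
  qed
  with D[of "zeta m"] have "map_poly (int_eval (zeta m)) D = 0" by simp
  then have "int_eval (zeta m) (coeff D k) = 0" for k
    by (metis coeff_map_poly coeff_0 int_eval.zero)
  then have "map_poly (int_eval \<omega>) D = 0"
    using sp by (simp add: poly_eq_iff coeff_map_poly)
  with D[of \<omega>] have "Polynomial.monom 1 m - 1 = (\<Prod>i<m. [: - (\<omega> ^ i), 1 :])" by simp
  then have "poly (Polynomial.monom 1 m - 1) \<epsilon> = poly (\<Prod>i<m. [: - (\<omega> ^ i), 1 :]) \<epsilon>" by simp
  then have "(\<Prod>i<m. \<epsilon> - \<omega> ^ i) = 0"
    using \<epsilon> by (simp add: poly_monom poly_prod)
  then show ?thesis by auto
qed

section \<open>Integrality of the cyclotomic norm form\<close>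

abbreviation coprimes :: "nat \<Rightarrow> nat set" where
  "coprimes m \<equiv> {i. i < m \<and> coprime i m}"

text \<open>Groups the residues by their gcd with \<open>m\<close>: the residue \<open>k\<close>
  belongs to the divisor \<open>m div gcd k m\<close>. The residue 0 falls under
  \<open>d = 1\<close>, since \<open>coprimes 1\<close> is \<open>{0}\<close>.\<close>

lemma sum_divisors_coprimes:
  fixes f :: "nat \<Rightarrow> 'a::comm_monoid_add"
  assumes "m \<ge> 1"
  shows "(\<Sum>d\<in>{d. d dvd m}. \<Sum>k\<in>coprimes d. f (k * (m div d))) = (\<Sum>k<m. f k)"
proof -
  have "(\<Sum>d\<in>{d. d dvd m}. \<Sum>k\<in>coprimes d. f (k * (m div d))) =
    (\<Sum>(d, k)\<in>(SIGMA d:{d. d dvd m}. coprimes d). f (k * (m div d)))"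
    using assms by (intro sum.Sigma) auto
  also have "\<dots> = (\<Sum>k<m. f k)"
  proof (rule sum.reindex_bij_witness[where i="\<lambda>k. (m div gcd k m, k div gcd k m)" and j="\<lambda>(d, k). k * (m div d)"])
    fix x assume "x \<in> (SIGMA d:{d. d dvd m}. coprimes d)"
    then obtain d k e where x: "x = (d, k)" "m = d * e" "k < d" "coprime k d" by auto
    have pos: "d > 0" "e > 0" using assms x by auto
    have g: "gcd (k * e) (d * e) = e"
      using x(4) by (simp add: gcd_mult_distrib_nat[symmetric] mult.commute[of _ e])
    show "(m div gcd (case x of (d, k) \<Rightarrow> k * (m div d)) m,
           (case x of (d, k) \<Rightarrow> k * (m div d)) div gcd (case x of (d, k) \<Rightarrow> k * (m div d)) m) = x"
      using x pos g by simp
    show "(case x of (d, k) \<Rightarrow> k * (m div d)) \<in> {..<m}"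
      using x pos by simp
    show "f (case x of (d, k) \<Rightarrow> k * (m div d)) = (case x of (d, k) \<Rightarrow> f (k * (m div d)))"
      using x by simp
  next
    fix k assume k: "k \<in> {..<m}"
    define g where "g = gcd k m"
    have g: "g > 0" "g dvd m" "g dvd k" unfolding g_def using assms by auto
    have mg: "m div (m div g) = g"
      using assms g by (simp add: div_div_eq_right)
    show "(case (m div gcd k m, k div gcd k m) of (d, k) \<Rightarrow> k * (m div d)) = k"
      using g mg by (simp flip: g_def)
    have "coprime (k div g) (m div g)"
      unfolding g_def using assms by (intro div_gcd_coprime) auto
    moreover have "k div g < m div g"
      using k g by (auto simp: less_mult_imp_div_less elim!: dvdE)
    moreover have "m div g dvd m" using g by (metis dvd_div_mult_self dvd_triv_left)
    ultimately show "(m div gcd k m, k div gcd k m) \<in> (SIGMA d:{d. d dvd m}. coprimes d)"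
      by (simp flip: g_def)
  qed
  finally show ?thesis .
qed

lemma sum_powers_root_of_unity_integer:
  fixes w :: complex
  assumes "w ^ m = 1"
  shows "(\<Sum>k<m. w ^ k) \<in> \<int>"
proof (cases "w = 1")
  case False
  then show ?thesis using assms by (simp add: geometric_sum)
qed simp

text \<open>Strong induction: the sum over all residues is \<open>m\<close> or 0, and the residues
  not coprime to \<open>m\<close> contribute the same kind of sum for the proper divisors of
  \<open>m\<close>.\<close>

lemma ramanujan_sum_integer:
  "m \<ge> 1 \<Longrightarrow> (\<Sum>k\<in>coprimes m. zeta m ^ (k * t)) \<in> \<int>"
proof (induction m rule: less_induct)
  case (less m)
  have eq: "zeta m ^ (k * (m div d) * t) = zeta d ^ (k * t)" if "d dvd m" for d k
  proof -
    from that obtain e where e: "m = d * e" by auto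
    with less.prems have "e > 0" "d > 0" by auto
    then show ?thesis
      unfolding zeta_pow e by (simp add: field_simps)
  qed
  have "(\<Sum>k<m. zeta m ^ (k * t)) \<in> \<int>"
    using sum_powers_root_of_unity_integer[of "zeta m ^ t" m] zeta_pow_self[OF less.prems]
    by (simp add: mult.commute flip: power_mult) (simp add: mult.commute power_mult)
  also have "(\<Sum>k<m. zeta m ^ (k * t)) = (\<Sum>d\<in>{d. d dvd m}. \<Sum>k\<in>coprimes d. zeta d ^ (k * t))"
    by (subst sum_divisors_coprimes[OF less.prems, symmetric]) (simp add: eq)
  also have "\<dots> = (\<Sum>k\<in>coprimes m. zeta m ^ (k * t)) +
      (\<Sum>d\<in>{d. d dvd m} - {m}. \<Sum>k\<in>coprimes d. zeta d ^ (k * t))"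
    using less.prems by (intro sum.remove) auto
  finally have "(\<Sum>k\<in>coprimes m. zeta m ^ (k * t)) +
      (\<Sum>d\<in>{d. d dvd m} - {m}. \<Sum>k\<in>coprimes d. zeta d ^ (k * t)) \<in> \<int>" .
  moreover have "(\<Sum>d\<in>{d. d dvd m} - {m}. \<Sum>k\<in>coprimes d. zeta d ^ (k * t)) \<in> \<int>"
  proof (rule Ints_sum)
    fix d assume d: "d \<in> {d. d dvd m} - {m}"
    with less.prems have "d \<ge> 1" "d \<le> m" by (auto dest: dvd_imp_le intro!: Suc_leI Nat.gr0I)
    with d have "d \<ge> 1" "d < m" by auto
    then show "(\<Sum>k\<in>coprimes d. zeta d ^ (k * t)) \<in> \<int>" by (intro less.IH)
  qed
  ultimately show ?case
    using Ints_diff[of "a + b" b for a b :: complex] unfolding add_diff_cancel_right' by blast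
qed

text \<open>A generic \<open>Psi m\<close> in which the root of unity is the indeterminate of the
  coefficient ring. It specialises both to the complex numbers and to the target field.\<close>

definition norm_form :: "nat \<Rightarrow> int poly mpoly" where
  "norm_form m = (\<Prod>i\<in>coprimes m. \<Sum>j<m. mConst (Polynomial.monom 1 (i * j)) * mVar j)"

lemma mpoly_ins_norm_form:
  fixes c :: "int poly \<Rightarrow> 'a::comm_ring_1"
  assumes "unital_ring_hom c"
  shows "mpoly_ins c y (norm_form m) = (\<Prod>i\<in>coprimes m. \<Sum>j<m. c (Polynomial.monom 1 (i * j)) * y j)"
proof -
  interpret H: unital_ring_hom "mpoly_ins c y" by (rule unital_ring_hom_mpoly_ins) fact
  show ?thesis
    by (simp add: norm_form_def H.prod H.sum H.mult assms)
qed

lemma lookup_mpoly_ins_mConst: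
  fixes c :: "'a::comm_ring_1 \<Rightarrow> 'b::comm_ring_1"
  assumes "c 0 = 0"
  shows "lookup (mpoly_ins (\<lambda>a. mConst (c a)) mVar p) m = c (lookup p m)"
proof -
  have "lookup (mpoly_ins (\<lambda>a. mConst (c a)) mVar p) m =
      (\<Sum>v\<in>keys p. lookup (Poly_Mapping.single v (c (lookup p v))) m)"
    by (simp add: mpoly_ins_def lookup_sum single_eq_mConst_mono_eval mono_eval_def)
  also have "\<dots> = (\<Sum>v\<in>keys p. if v = m then c (lookup p v) else 0)"
    by (rule sum.cong) (auto simp: lookup_single when_def)
  also have "\<dots> = c (lookup p m)"
    using assms by (simp add: in_keys_iff)
  finally show ?thesis .
qed

text \<open>Passing to a conjugate root of unity only permutes the factors of \<open>Psi m\<close>,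
  by multiplication with \<open>k\<close> modulo \<open>m\<close>.\<close>

lemma norm_form_zeta_conjugate:
  assumes "k \<in> coprimes m"
  shows "mpoly_ins (\<lambda>p. mConst (int_eval (zeta m ^ k) p)) mVar (norm_form m) = Psi m"
proof -
  have m: "m \<ge> 1" using assms by auto
  define \<pi> where "\<pi> = (\<lambda>i. (k * i) mod m)"
  have inj: "inj_on \<pi> (coprimes m)"
  proof (rule linorder_inj_onI')
    fix i j assume ij: "i \<in> coprimes m" "j \<in> coprimes m" "i < j"
    show "\<pi> i \<noteq> \<pi> j"
    proof
      assume "\<pi> i = \<pi> j"
      then have "m dvd k * j - k * i"
        unfolding \<pi>_def using ij by (metis mod_eq_dvd_iff_nat mult_le_mono2 less_imp_le)
      then have "m dvd k * (j - i)" by (simp add: diff_mult_distrib2)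
      then have "m dvd j - i"
        using assms by (simp add: coprime_dvd_mult_right_iff coprime_commute)
      with ij show False by (auto dest: dvd_imp_le)
    qed
  qed
  have "\<pi> ` coprimes m \<subseteq> coprimes m"
    using assms m by (auto simp: \<pi>_def)
  with inj have bij: "bij_betw \<pi> (coprimes m) (coprimes m)"
    by (simp add: bij_betw_def endo_inj_surj)
  have "mpoly_ins (\<lambda>p. mConst (int_eval (zeta m ^ k) p)) mVar (norm_form m) =
     (\<Prod>i\<in>coprimes m. \<Sum>j<m. mConst ((zeta m ^ k) ^ (i * j)) * mVar j)"
    by (subst mpoly_ins_norm_form[OF unital_ring_hom_comp[OF unital_ring_hom_mConst unital_ring_hom_int_eval]]) simp
  also have "\<dots> = (\<Prod>i\<in>coprimes m. \<Sum>j<m. mConst (zeta m ^ (\<pi> i * j)) * mVar j)"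
  proof -
    have "(zeta m ^ k) ^ (i * j) = zeta m ^ (\<pi> i * j)" for i j
      using zeta_pow_mod[OF m, of "k * i"] by (simp add: \<pi>_def power_mult)
    then show ?thesis by simp
  qed
  also have "\<dots> = (\<Prod>i\<in>coprimes m. \<Sum>j<m. mConst (zeta m ^ (i * j)) * mVar j)"
    by (rule prod.reindex_bij_betw[OF bij])
  also have "\<dots> = Psi m" by (simp add: Psi_def zeta_def)
  finally show ?thesis .
qed

lemma int_eval_norm_form_coeff:
  assumes "k \<in> coprimes m"
  shows "int_eval (zeta m ^ k) (lookup (norm_form m) v) = lookup (Psi m) v"
  using lookup_mpoly_ins_mConst[of "int_eval (zeta m ^ k)" "norm_form m" v]
  by (simp add: norm_form_zeta_conjugate[OF assms])

text \<open>The coefficients are their own conjugates, so \<open>\<phi>(m)\<close> times a coefficient is an integer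
  combination of Ramanujan sums.\<close>

lemma Psi_coeff_integer:
  assumes m: "m \<ge> 1"
  shows "lookup (Psi m) v \<in> \<int>" "int_eval (zeta m) (lookup (norm_form m) v) = lookup (Psi m) v"
proof -
  define p where "p = lookup (norm_form m) v"
  define U where "U = coprimes m"
  have U: "finite U" "U \<noteq> {}"
  proof -
    have "(if m = 1 then 0 else 1) \<in> U" using m by (auto simp: U_def)
    then show "U \<noteq> {}" by blast
  qed (simp add: U_def)
  \<comment> \<open>The exponent 1 belongs to \<open>coprimes m\<close> unless \<open>m = 1\<close>;
    in that case \<open>zeta m\<close> is 1 and the exponent 0 serves.\<close>
  show p1: "int_eval (zeta m) (lookup (norm_form m) v) = lookup (Psi m) v"
  proof (cases "m = 1")
    case True
    then have "zeta m = zeta m ^ 0" by (simp add: zeta_def)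
    with int_eval_norm_form_coeff[of 0 m v] True show ?thesis by simp
  qed (use int_eval_norm_form_coeff[of 1 m v] m in simp)
  have "of_nat (card U) * lookup (Psi m) v = (\<Sum>k\<in>U. int_eval (zeta m ^ k) p)"
    by (simp add: p_def int_eval_norm_form_coeff U_def)
  also have "\<dots> = (\<Sum>t\<le>Polynomial.degree p. of_int (coeff p t) * (\<Sum>k\<in>U. zeta m ^ (k * t)))"
    unfolding int_eval_altdef power_mult sum_distrib_left by (rule sum.swap)
  also have "\<dots> \<in> \<int>"
    unfolding U_def by (intro Ints_sum Ints_mult ramanujan_sum_integer m) simp
  finally obtain M where M: "of_nat (card U) * lookup (Psi m) v = of_int M"
    by (auto elim: Ints_cases)
  have "int_eval (zeta m) p \<in> \<int>"
    by (rule int_eval_root_of_unity_integer[OF zeta_pow_self[OF m] m, of "int (card U)" p M])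
       (use U M p1 in \<open>simp_all add: p_def card_gt_0_iff\<close>)
  then show "lookup (Psi m) v \<in> \<int>" by (simp add: p_def p1)
qed

section \<open>Integer polynomials as complex polynomials, and the integral form of
  \<open>Psi\<close>\<close>

abbreviation int_emb :: "int mpoly \<Rightarrow> complex mpoly" where
  "int_emb \<equiv> mpoly_ins of_int mVar"

lemma of_int_mpoly_eq: "(of_int :: int \<Rightarrow> 'a::comm_ring_1 mpoly) = (\<lambda>k. mConst (of_int k))"
  by (simp add: fun_eq_iff unital_ring_hom.of_int[OF unital_ring_hom_mConst])

lemma lookup_int_emb: "lookup (int_emb p) m = of_int (lookup p m)"
  unfolding of_int_mpoly_eq by (rule lookup_mpoly_ins_mConst) simp

lemma int_emb_inj: "int_emb p = int_emb q \<longleftrightarrow> p = q"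
  by (metis lookup_int_emb of_int_eq_iff poly_mapping_eqI)

text \<open>Each coefficient of \<open>norm_form m\<close> differs from the corresponding integer
  coefficient of \<open>P\<close> by a polynomial vanishing at \<open>zeta m\<close>, and this
  relation survives at \<open>\<omega>\<close>. So \<open>P\<close> factors at
  \<open>\<omega>\<close> just as \<open>Psi m\<close> does over the complex numbers.\<close>

lemma Psi_integral:
  assumes m: "m \<ge> 1"
  obtains P :: "int mpoly" where "int_emb P = Psi m"
    "\<And>(\<omega> :: 'k::comm_ring_1) (y :: nat \<Rightarrow> 'k). (\<And>p. int_eval (zeta m) p = 0 \<Longrightarrow> int_eval \<omega> p = 0) \<Longrightarrow>
       mpoly_ins of_int y P = (\<Prod>i\<in>coprimes m. \<Sum>j<m. \<omega> ^ (i * j) * y j)"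
proof -
  \<comment> \<open>The coefficients are integers embedded in the complex numbers; real part and
    floor retrieve them.\<close>
  define P where "P = Poly_Mapping.map (\<lambda>c. \<lfloor>Re c\<rfloor>) (Psi m)"
  have lP: "of_int (lookup P v) = lookup (Psi m) v" for v
    using Psi_coeff_integer(1)[OF m, of v]
    by (auto simp: P_def Poly_Mapping.map.rep_eq when_def elim: Ints_cases)
  show ?thesis
  proof (rule that)
    show "int_emb P = Psi m"
      by (rule poly_mapping_eqI) (simp add: lookup_int_emb lP)
    fix \<omega> :: 'k and y :: "nat \<Rightarrow> 'k"
    assume sp: "\<And>p. int_eval (zeta m) p = 0 \<Longrightarrow> int_eval \<omega> p = 0"
    have co: "int_eval \<omega> (lookup (norm_form m) v) = of_int (lookup P v)" for v
    proof -
      have "int_eval (zeta m) (lookup (norm_form m) v - [:lookup P v:]) = 0"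
        by (simp add: int_eval.diff Psi_coeff_integer(2)[OF m] lP)
      from sp[OF this] show ?thesis by (simp add: int_eval.diff)
    qed
    let ?A = "keys P \<union> keys (norm_form m)"
    have "mpoly_ins of_int y P = (\<Sum>v\<in>?A. of_int (lookup P v) * mono_eval y v)"
      by (rule mpoly_ins_superset) simp_all
    also have "\<dots> = mpoly_ins (int_eval \<omega>) y (norm_form m)"
      by (subst mpoly_ins_superset[of ?A]) (simp_all add: co)
    also have "\<dots> = (\<Prod>i\<in>coprimes m. \<Sum>j<m. \<omega> ^ (i * j) * y j)"
      by (simp add: mpoly_ins_norm_form[OF unital_ring_hom_int_eval])
    finally show "mpoly_ins of_int y P = (\<Prod>i\<in>coprimes m. \<Sum>j<m. \<omega> ^ (i * j) * y j)" .
  qed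
qed

section \<open>The polynomials Phi and Theta\<close>

lemma unital_ring_hom_mpoly_ins_comp:
  fixes F :: "'b::comm_ring_1 \<Rightarrow> 'c::comm_ring_1" and c :: "'a::comm_ring_1 \<Rightarrow> 'b"
  assumes "unital_ring_hom F" "unital_ring_hom c"
  shows "F (mpoly_ins c g p) = mpoly_ins (\<lambda>a. F (c a)) (\<lambda>i. F (g i)) p"
  using unital_ring_hom_mpoly_eq[OF unital_ring_hom_comp[OF assms(1) unital_ring_hom_mpoly_ins[OF assms(2)]]]
  by (simp add: assms)

lemma unital_ring_hom_int_emb: "unital_ring_hom int_emb"
  by (rule unital_ring_hom_mpoly_ins[OF unital_ring_hom_of_int])

interpretation int_emb: unital_ring_hom int_emb
  by (rule unital_ring_hom_int_emb)

lemma int_emb_mVar [simp]: "int_emb (mVar i) = mVar i"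
  by (simp add: unital_ring_hom_of_int)

lemma mpoly_ins_int_emb:
  "mpoly_ins mConst (\<lambda>i. int_emb (g i)) (int_emb q) = int_emb (mpoly_ins of_int g q)"
  using unital_ring_hom_mpoly_ins_int[OF unital_ring_hom_mpoly_ins[OF unital_ring_hom_mConst], of "\<lambda>i. int_emb (g i)" mVar q]
    unital_ring_hom_mpoly_ins_int[OF unital_ring_hom_int_emb, of g q]
  by (simp add: unital_ring_hom_mConst)

lemma mConst_int_eq: "(mConst :: int \<Rightarrow> int mpoly) = of_int"
  by (simp add: fun_eq_iff)

lemma mrename_int: "mrename \<sigma> (p :: int mpoly) = mpoly_ins of_int (\<lambda>i. mVar (\<sigma> i)) p"
  by (simp add: mrename_def mConst_int_eq)

lemma mrename_int_emb: "mrename \<sigma> (int_emb q) = int_emb (mrename \<sigma> q)"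
  using mpoly_ins_int_emb[of "\<lambda>i. mVar (\<sigma> i)" q] by (simp add: mrename_def[of \<sigma> "int_emb q"] mrename_int)

lemma msymmetric_int_emb: "msymmetric n (int_emb q) \<longleftrightarrow> msymmetric n q"
  by (simp add: msymmetric_def mrename_int_emb int_emb_inj)

lemma mpoly_vars_int_emb: "mpoly_vars (int_emb p) = mpoly_vars p"
  by (auto simp: mpoly_vars_def in_keys_iff lookup_int_emb)

text \<open>One element per left coset of the stabilizer, which removes the choice of
  representatives from \<open>Phi\<close>.\<close>

definition Psi_orbit :: "nat \<Rightarrow> complex mpoly set" where
  "Psi_orbit m = (\<lambda>\<sigma>. mrename \<sigma> (Psi m)) ` {\<sigma>. \<sigma> permutes {..<m}}"

lemma finite_Psi_orbit: "finite (Psi_orbit m)"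
  by (simp add: Psi_orbit_def finite_permutations)

lemma Psi_in_orbit: "Psi m \<in> Psi_orbit m"
  unfolding Psi_orbit_def by (rule image_eqI[of _ _ id]) (simp_all add: permutes_id)

text \<open>Orbit-stabilizer correspondence for the left action by \<open>mrename\<close>.\<close>

lemma same_Stab_coset_iff:
  assumes "\<sigma> permutes {..<m}" "\<tau> permutes {..<m}"
  shows "(\<exists>\<rho>\<in>Stab_Psi m. \<sigma> = \<tau> \<circ> \<rho>) \<longleftrightarrow> mrename \<sigma> (Psi m) = mrename \<tau> (Psi m)"
proof
  assume "\<exists>\<rho>\<in>Stab_Psi m. \<sigma> = \<tau> \<circ> \<rho>"
  then show "mrename \<sigma> (Psi m) = mrename \<tau> (Psi m)"
    by (auto simp: Stab_Psi_def simp flip: mrename_mrename)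
next
  assume eq: "mrename \<sigma> (Psi m) = mrename \<tau> (Psi m)"
  let ?i = "Hilbert_Choice.inv \<tau>"
  have "mrename (?i \<circ> \<sigma>) (Psi m) = mrename (?i \<circ> \<tau>) (Psi m)"
    by (simp add: eq flip: mrename_mrename)
  also have "\<dots> = Psi m" by (simp add: permutes_inv_o[OF assms(2)])
  finally have "?i \<circ> \<sigma> \<in> Stab_Psi m"
    using permutes_compose[OF assms(1) permutes_inv[OF assms(2)]] by (simp add: Stab_Psi_def)
  moreover have "\<sigma> = \<tau> \<circ> (?i \<circ> \<sigma>)"
    by (simp add: fun_eq_iff permutes_inverses[OF assms(2)])
  ultimately show "\<exists>\<rho>\<in>Stab_Psi m. \<sigma> = \<tau> \<circ> \<rho>" by blast
qed

lemma coset_reps_iff: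
  "coset_reps m C \<longleftrightarrow> C \<subseteq> {\<sigma>. \<sigma> permutes {..<m}} \<and>
     (\<forall>\<sigma>. \<sigma> permutes {..<m} \<longrightarrow> (\<exists>!\<tau>. \<tau> \<in> C \<and> mrename \<tau> (Psi m) = mrename \<sigma> (Psi m)))"
proof (cases "C \<subseteq> {\<sigma>. \<sigma> permutes {..<m}}")
  case True
  then have "(\<tau> \<in> C \<and> (\<exists>\<rho>\<in>Stab_Psi m. \<sigma> = \<tau> \<circ> \<rho>)) \<longleftrightarrow> (\<tau> \<in> C \<and> mrename \<tau> (Psi m) = mrename \<sigma> (Psi m))"
    if "\<sigma> permutes {..<m}" for \<sigma> \<tau>
  proof (cases "\<tau> \<in> C")
    case True
    with \<open>C \<subseteq> _\<close> have "\<tau> permutes {..<m}" by auto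
    then show ?thesis by (simp add: same_Stab_coset_iff[OF that] eq_commute)
  qed simp
  then show ?thesis unfolding coset_reps_def by simp
qed (simp add: coset_reps_def)

text \<open>\<open>Phi\<close> selects its representatives by \<open>SOME\<close>, so a system has
  to exist; one preimage is taken for every point of the orbit.\<close>

lemma coset_reps_exists: "\<exists>C. coset_reps m C"
proof -
  define S where "S = {\<sigma>. \<sigma> permutes {..<m}}"
  define act where "act = (\<lambda>\<sigma>. mrename \<sigma> (Psi m))"
  define C where "C = inv_into S act ` act ` S"
  have "C \<subseteq> S" unfolding C_def by (auto intro: inv_into_into)
  moreover have "\<exists>!\<tau>. \<tau> \<in> C \<and> act \<tau> = act \<sigma>" if "\<sigma> \<in> S" for \<sigma>
  proof (rule ex1I[of _ "inv_into S act (act \<sigma>)"])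
    show "inv_into S act (act \<sigma>) \<in> C \<and> act (inv_into S act (act \<sigma>)) = act \<sigma>"
      using that by (auto simp: C_def f_inv_into_f)
    show "\<tau> = inv_into S act (act \<sigma>)" if "\<tau> \<in> C \<and> act \<tau> = act \<sigma>" for \<tau>
      using that by (auto simp: C_def f_inv_into_f)
  qed
  ultimately have "coset_reps m C" by (simp add: coset_reps_iff S_def act_def)
  then show ?thesis ..
qed

lemma Phi_eq_prod_orbit: "Phi m = \<Prod>(Psi_orbit m)"
proof -
  define C where "C = (SOME C. coset_reps m C)"
  have C: "coset_reps m C" unfolding C_def by (rule someI_ex[OF coset_reps_exists])
  have "inj_on (\<lambda>\<sigma>. mrename \<sigma> (Psi m)) C"
    using C by (intro inj_onI) (auto simp: coset_reps_iff)
  moreover have "(\<lambda>\<sigma>. mrename \<sigma> (Psi m)) ` C = Psi_orbit m"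
  proof
    show "(\<lambda>\<sigma>. mrename \<sigma> (Psi m)) ` C \<subseteq> Psi_orbit m"
      using C by (auto simp: coset_reps_iff Psi_orbit_def)
    show "Psi_orbit m \<subseteq> (\<lambda>\<sigma>. mrename \<sigma> (Psi m)) ` C"
    proof
      fix p assume "p \<in> Psi_orbit m"
      then obtain \<sigma> where "\<sigma> permutes {..<m}" "p = mrename \<sigma> (Psi m)" by (auto simp: Psi_orbit_def)
      with C obtain \<tau> where "\<tau> \<in> C" "p = mrename \<tau> (Psi m)" unfolding coset_reps_iff by metis
      then show "p \<in> (\<lambda>\<sigma>. mrename \<sigma> (Psi m)) ` C" by blast
    qed
  qed
  ultimately show ?thesis
    unfolding Phi_def C_def[symmetric] by (metis prod.reindex_cong)
qed

text \<open>A permutation of the variables permutes the orbit of \<open>Psi m\<close>.\<close>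

lemma msymmetric_Phi: "msymmetric m (Phi m)"
  unfolding msymmetric_def
proof (intro allI impI)
  fix \<pi> :: "nat \<Rightarrow> nat" assume \<pi>: "\<pi> permutes {..<m}"
  have closed: "mrename \<tau> p \<in> Psi_orbit m" if "\<tau> permutes {..<m}" "p \<in> Psi_orbit m" for \<tau> p
    using that by (auto simp: Psi_orbit_def mrename_mrename intro!: imageI permutes_compose)
  have bij: "bij_betw (mrename \<pi>) (Psi_orbit m) (Psi_orbit m)"
    by (rule bij_betw_byWitness[where f'="mrename (Hilbert_Choice.inv \<pi>)"])
       (auto simp: mrename_mrename permutes_inv_o[OF \<pi>] intro: closed \<pi> permutes_inv)
  show "mrename \<pi> (Phi m) = Phi m"
    unfolding Phi_eq_prod_orbit unital_ring_hom.prod[OF unital_ring_hom_mrename]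
    by (rule prod.reindex_bij_betw[OF bij])
qed

text \<open>\<open>Psi m\<close> is a point of its own orbit, and its images are integral along with
  it. Keeping \<open>P\<close> as an explicit factor lets its vanishing pass to
  \<open>Phi m\<close>.\<close>

lemma Phi_integral:
  assumes "int_emb P = Psi m"
  obtains R where "int_emb (P * R) = Phi m"
proof -
  have "\<exists>q. int_emb q = p" if "p \<in> Psi_orbit m" for p
    using that by (auto simp: Psi_orbit_def mrename_int_emb simp flip: assms)
  then obtain q where q: "\<And>p. p \<in> Psi_orbit m \<Longrightarrow> int_emb (q p) = p" by metis
  have "Phi m = Psi m * \<Prod>(Psi_orbit m - {Psi m})"
    unfolding Phi_eq_prod_orbit by (rule prod.remove[OF finite_Psi_orbit Psi_in_orbit])
  also have "\<Prod>(Psi_orbit m - {Psi m}) = int_emb (\<Prod>p\<in>Psi_orbit m - {Psi m}. q p)"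
    by (simp add: int_emb.prod q)
  finally show ?thesis using that assms by (metis int_emb.mult)
qed

text \<open>Two enumerations of the blocks differ by a permutation of the indices, which the
  symmetry of \<open>p\<close> absorbs. This makes the enumerations chosen inside
  \<open>Theta\<close> immaterial.\<close>

lemma msymmetric_mpoly_ins_bij:
  fixes c :: "'a::comm_ring_1 \<Rightarrow> 'b::comm_ring_1"
  assumes "unital_ring_hom c" "msymmetric m p" "bij_betw g {..<m} P" "bij_betw g' {..<m} P"
  shows "mpoly_ins c (\<lambda>j. if j < m then F (g j) else 0) p = mpoly_ins c (\<lambda>j. if j < m then F (g' j) else 0) p"
proof -
  \<comment> \<open>Below \<open>m\<close>, \<open>\<pi>\<close> is the solution of
    \<open>g (\<pi> j) = g' j\<close>; it is the identity elsewhere, as \<open>permutes\<close>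
    demands.\<close>
  define \<pi> where "\<pi> = (\<lambda>j. if j < m then inv_into {..<m} g (g' j) else j)"
  have gi: "bij_betw (inv_into {..<m} g \<circ> g') {..<m} {..<m}"
    by (rule bij_betw_trans[OF assms(4) bij_betw_inv_into[OF assms(3)]])
  then have "bij_betw \<pi> {..<m} {..<m}"
    by (rule bij_betw_cong[THEN iffD1, rotated]) (simp add: \<pi>_def)
  then have \<pi>: "\<pi> permutes {..<m}"
    by (rule bij_imp_permutes) (simp add: \<pi>_def)
  have lt: "\<pi> j < m \<longleftrightarrow> j < m" for j
    using permutes_in_image[OF \<pi>, of j] by simp
  have g': "g (\<pi> j) = g' j" if "j < m" for j
  proof -
    have "g' j \<in> g ` {..<m}" using that assms(3,4) unfolding bij_betw_def by blast
    with that show ?thesis by (simp add: \<pi>_def f_inv_into_f)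
  qed
  have "mpoly_ins c (\<lambda>j. if j < m then F (g j) else 0) p =
      mpoly_ins c (\<lambda>j. if j < m then F (g j) else 0) (mrename \<pi> p)"
    using assms(2) \<pi> by (simp add: msymmetric_def)
  also have "\<dots> = mpoly_ins c (\<lambda>j. if \<pi> j < m then F (g (\<pi> j)) else 0) p"
    by (rule mpoly_ins_mrename) fact
  also have "(\<lambda>j. if \<pi> j < m then F (g (\<pi> j)) else 0) = (\<lambda>j. if j < m then F (g' j) else 0)"
    by (simp add: fun_eq_iff lt g')
  finally show ?thesis .
qed

section \<open>Partitions into blocks of equal size, and \<open>Theta\<close>\<close>

definition blocks :: "nat \<Rightarrow> nat set set \<Rightarrow> nat \<Rightarrow> nat set" where
  "blocks m P = (SOME g. bij_betw g {..<m} P)"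

lemma part_setD:
  assumes "P \<in> part_set n m"
  shows "partition_on {..<n} P" "finite P" "card P = m"
  using assms finite_elements[of "{..<n}" P] by (auto simp: part_set_def)

lemma finite_part_set: "finite (part_set n m)"
  by (rule finite_subset[of _ "Pow (Pow {..<n})"]) (auto simp: part_set_def partition_on_def)

lemma bij_betw_blocks:
  assumes "P \<in> part_set n m"
  shows "bij_betw (blocks m P) {..<m} P"
proof -
  have "\<exists>g. bij_betw g {..<m} P"
    using part_setD[OF assms] by (intro finite_same_card_bij) auto
  then show ?thesis unfolding blocks_def by (rule someI_ex)
qed

lemma Theta_altdef:
  "Theta n m = (\<Prod>P\<in>part_set n m.
     mpoly_ins mConst (\<lambda>j. if j < m then \<Sum>a\<in>blocks m P j. mVar a else 0) (Phi m))"
  unfolding Theta_def blocks_def Let_def ..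

lemma image_part_set:
  assumes "\<pi> permutes {..<n}" "P \<in> part_set n m"
  shows "(`) \<pi> ` P \<in> part_set n m"
proof -
  have inj: "inj \<pi>" by (rule permutes_inj) fact
  have "partition_on (\<pi> ` {..<n}) ((`) \<pi> ` P)"
    unfolding partition_on_def disjoint_def
  proof (intro conjI ballI impI)
    note P = part_setD(1)[OF assms(2), unfolded partition_on_def disjoint_def]
    show "\<Union> ((`) \<pi> ` P) = \<pi> ` {..<n}" using P by (simp add: image_Union[symmetric])
    show "{} \<notin> (`) \<pi> ` P" using P by auto
    fix A B assume "A \<in> (`) \<pi> ` P" "B \<in> (`) \<pi> ` P" "A \<noteq> B"
    then obtain A' B' where "A = \<pi> ` A'" "B = \<pi> ` B'" "A' \<in> P" "B' \<in> P" "A' \<noteq> B'" by auto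
    moreover from this P have "A' \<inter> B' = {}" by blast
    ultimately show "A \<inter> B = {}" by (simp add: image_Int[OF inj, symmetric])
  qed
  then have "partition_on {..<n} ((`) \<pi> ` P)"
    by (simp add: permutes_image[OF assms(1)])
  moreover have "card ((`) \<pi> ` P) = card P"
    by (rule card_image) (metis inj inj_image_eq_iff inj_onI)
  moreover have "card (\<pi> ` B) = card B" for B
    by (rule card_image) (metis inj inj_on_subset subset_UNIV)
  ultimately show ?thesis using assms(2) by (auto simp: part_set_def)
qed

text \<open>A permutation carries the factor of \<open>P\<close> to the factor of the image
  partition, up to the enumeration of its blocks, and the image partitions run through all of
  \<open>part_set n m\<close>.\<close>

lemma msymmetric_Theta: "msymmetric n (Theta n m)"
  unfolding msymmetric_def
proof (intro allI impI)
  fix \<pi> :: "nat \<Rightarrow> nat" assume \<pi>: "\<pi> permutes {..<n}"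
  have inj: "inj \<pi>" by (rule permutes_inj) fact
  define T where "T = (\<lambda>P. mpoly_ins mConst (\<lambda>j. if j < m then \<Sum>a\<in>blocks m P j. mVar a else 0) (Phi m))"
  have bij: "bij_betw ((`) ((`) \<pi>)) (part_set n m) (part_set n m)"
  proof (rule bij_betw_byWitness[where f'="(`) ((`) (Hilbert_Choice.inv \<pi>))"])
    show "\<forall>P\<in>part_set n m. (`) (Hilbert_Choice.inv \<pi>) ` (`) \<pi> ` P = P"
      by (simp add: image_image permutes_inverses[OF \<pi>])
    show "\<forall>P\<in>part_set n m. (`) \<pi> ` (`) (Hilbert_Choice.inv \<pi>) ` P = P"
      by (simp add: image_image permutes_inverses[OF \<pi>])
  qed (auto intro: image_part_set \<pi> permutes_inv)
  have "mrename \<pi> (T P) = T ((`) \<pi> ` P)" if P: "P \<in> part_set n m" for P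
  proof -
    have ren: "mrename \<pi> (if j < m then \<Sum>a\<in>blocks m P j. mVar a else 0) =
        (if j < m then \<Sum>a\<in>\<pi> ` blocks m P j. mVar a else (0 :: complex mpoly))" for j
      by (simp add: unital_ring_hom.sum[OF unital_ring_hom_mrename]
          unital_ring_hom.zero[OF unital_ring_hom_mrename] sum.reindex[OF inj_on_subset[OF inj subset_UNIV]])
    have "mrename \<pi> (T P) = mpoly_ins mConst (\<lambda>j. if j < m then \<Sum>a\<in>\<pi> ` blocks m P j. mVar a else 0) (Phi m)"
      unfolding T_def
      by (subst unital_ring_hom_mpoly_ins_comp[OF unital_ring_hom_mrename unital_ring_hom_mConst])
         (simp only: mrename_mConst ren)
    also have "\<dots> = T ((`) \<pi> ` P)"
      unfolding T_def
    proof (rule msymmetric_mpoly_ins_bij[OF unital_ring_hom_mConst msymmetric_Phi,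
          where F="\<lambda>B. \<Sum>a\<in>B. mVar a" and g="\<lambda>j. \<pi> ` blocks m P j"])
      show "bij_betw (blocks m ((`) \<pi> ` P)) {..<m} ((`) \<pi> ` P)"
        by (rule bij_betw_blocks[OF image_part_set[OF \<pi> P]])
      have "bij_betw ((`) \<pi>) P ((`) \<pi> ` P)"
        by (rule inj_on_imp_bij_betw) (metis inj inj_image_eq_iff inj_onI)
      from bij_betw_trans[OF bij_betw_blocks[OF P] this]
      show "bij_betw (\<lambda>j. \<pi> ` blocks m P j) {..<m} ((`) \<pi> ` P)" by (simp add: o_def)
    qed
    finally show ?thesis .
  qed
  then have "mrename \<pi> (Theta n m) = (\<Prod>P\<in>part_set n m. T ((`) \<pi> ` P))"
    by (simp add: Theta_altdef unital_ring_hom.prod[OF unital_ring_hom_mrename] T_def)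
  also have "\<dots> = (\<Prod>P\<in>part_set n m. T P)"
    by (rule prod.reindex_bij_betw[OF bij])
  finally show "mrename \<pi> (Theta n m) = Theta n m" by (simp add: Theta_altdef T_def)
qed

lemma mpoly_vars_Theta: "mpoly_vars (Theta n m) \<subseteq> {..<n}"
  unfolding Theta_altdef
proof (intro mpoly_vars_prod_subset mpoly_vars_mpoly_ins_subset)
  fix P j assume P: "P \<in> part_set n m"
  show "mpoly_vars (if j < m then \<Sum>a\<in>blocks m P j. mVar a else 0 :: complex mpoly) \<subseteq> {..<n}"
  proof (cases "j < m")
    case True
    with bij_betw_blocks[OF P] have "blocks m P j \<in> P" by (auto simp: bij_betw_def)
    with part_setD(1)[OF P] have "blocks m P j \<subseteq> {..<n}" by (auto simp: partition_on_def)
    then have "mpoly_vars (\<Sum>a\<in>blocks m P j. mVar a :: complex mpoly) \<subseteq> {..<n}"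
      using mpoly_vars_mVar by (intro mpoly_vars_sum_subset) fastforce
    with True show ?thesis by simp
  qed (simp add: mpoly_vars_def)
qed (simp add: mpoly_vars_mConst)

text \<open>Supplies the integer polynomial to which the fundamental theorem is applied, so that
  \<open>theta\<close> has integer coefficients.\<close>

lemma Theta_integral:
  assumes "int_emb Q = Phi m"
  shows "int_emb (\<Prod>P\<in>part_set n m. mpoly_ins of_int (\<lambda>j. if j < m then \<Sum>a\<in>blocks m P j. mVar a else 0) Q)
     = Theta n m"
proof -
  have "int_emb (if j < m then \<Sum>a\<in>blocks m P j. mVar a else 0) = (if j < m then \<Sum>a\<in>blocks m P j. mVar a else 0)"
    for j and P :: "nat set set"
    by (simp add: int_emb.sum)
  then show ?thesis
    by (simp add: Theta_altdef int_emb.prod assms[symmetric] mpoly_ins_int_emb[symmetric])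
qed

lemma int_emb_esym: "int_emb (esym n i) = esym n i"
  by (simp add: esym_def int_emb.sum int_emb.prod)

text \<open>Justifies the definite description in \<open>theta\<close>: existence is the fundamental
  theorem over the integers, uniqueness is algebraic independence.\<close>

lemma theta_spec:
  assumes "int_emb T = Theta n m"
  shows "mpoly_vars (theta n m) \<subseteq> {1..n}" "mpoly_ins of_int (esym n) (theta n m) = T"
proof -
  let ?Q = "\<lambda>p. mpoly_vars p \<subseteq> {1..n} \<and> mpoly_ins of_int (\<lambda>i. esym n i) p = Theta n m"
  \<comment> \<open>Injectivity of \<open>int_emb\<close> moves the defining equation from complex
    to integer polynomials.\<close>
  have iff: "mpoly_ins of_int (\<lambda>i. esym n i) p = Theta n m \<longleftrightarrow> mpoly_ins of_int (esym n) p = T" for p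
  proof -
    have "mpoly_ins of_int (\<lambda>i. esym n i) p = int_emb (mpoly_ins of_int (esym n) p)"
      by (simp add: unital_ring_hom_mpoly_ins_int[OF unital_ring_hom_int_emb] int_emb_esym)
    then show ?thesis by (simp add: int_emb_inj flip: assms)
  qed
  have "msymmetric n T" "mpoly_vars T \<subseteq> {..<n}"
    using msymmetric_Theta[of n m] mpoly_vars_Theta[of n m]
    by (simp_all add: msymmetric_int_emb mpoly_vars_int_emb flip: assms)
  from msymmetric_eq_esym_poly[OF this] obtain p where p: "?Q p"
    unfolding iff mConst_int_eq by blast
  have "\<exists>!p. ?Q p"
  proof (rule ex1I[of _ p])
    show "?Q p" by (rule p)
    fix q assume q: "?Q q"
    interpret ins: unital_ring_hom "mpoly_ins of_int (esym n :: nat \<Rightarrow> int mpoly)"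
      by (rule unital_ring_hom_mpoly_ins[OF unital_ring_hom_of_int])
    have "mpoly_ins of_int (esym n) (q - p) = (0 :: int mpoly)"
      using p q by (simp add: iff ins.diff)
    moreover have "mpoly_vars (q - p) \<subseteq> {1..n}"
      using mpoly_vars_add[of q "- p"] p q by (auto simp: mpoly_vars_uminus)
    ultimately have "q - p = 0"
      by (intro esym_algebraically_independent[of "q - p" n]) (simp_all add: mConst_int_eq)
    then show "q = p" by simp
  qed
  then have "?Q (theta n m)" unfolding theta_def by (rule theI')
  then show "mpoly_vars (theta n m) \<subseteq> {1..n}" "mpoly_ins of_int (esym n) (theta n m) = T"
    by (auto simp: iff)
qed

text \<open>This partition yields the vanishing factor of \<open>Theta\<close>; its enumeration by
  residues matches the exponents in the linear factors of \<open>Psi m\<close>.\<close>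

lemma residue_classes_part_set:
  assumes "m \<ge> 1" "m dvd n" "n \<ge> 1"
  defines "R \<equiv> \<lambda>j. {i. i < n \<and> i mod m = j}"
  shows "R ` {..<m} \<in> part_set n m" "bij_betw R {..<m} (R ` {..<m})"
proof -
  have le: "m \<le> n" using assms by (auto dest: dvd_imp_le)
  have memR: "j \<in> R j" if "j < m" for j using that le by (simp add: R_def)
  have inj: "inj_on R {..<m}"
  proof (rule inj_onI)
    fix x y assume "x \<in> {..<m}" "R x = R y"
    with memR[of x] have "x \<in> R y" by auto
    with \<open>x \<in> {..<m}\<close> show "x = y" by (simp add: R_def)
  qed
  then show "bij_betw R {..<m} (R ` {..<m})" by (rule inj_on_imp_bij_betw)
  have card: "card (R j) = n div m" if "j < m" for j
  proof -
    from assms(2) obtain t where t: "n = m * t" by auto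
    have "R j = (\<lambda>s. s * m + j) ` {..<t}"
    proof
      show "(\<lambda>s. s * m + j) ` {..<t} \<subseteq> R j"
      proof clarify
        fix s assume "s < t"
        then have "Suc s * m \<le> t * m" by (intro mult_le_mono1) simp
        with that show "s * m + j \<in> R j" by (simp add: R_def t mult.commute)
      qed
      show "R j \<subseteq> (\<lambda>s. s * m + j) ` {..<t}"
      proof
        fix i assume i: "i \<in> R j"
        have "i div m < t" using i by (auto simp: R_def t less_mult_imp_div_less mult.commute)
        moreover have "i = (i div m) * m + j" using i by (auto simp: R_def)
        ultimately show "i \<in> (\<lambda>s. s * m + j) ` {..<t}" by blast
      qed
    qed
    moreover have "inj_on (\<lambda>s. s * m + j) {..<t}" using assms(1) by (auto intro: inj_onI)
    ultimately show ?thesis using assms(1) by (simp add: card_image t)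
  qed
  have "partition_on {..<n} (R ` {..<m})"
    unfolding partition_on_def disjoint_def
  proof (intro conjI ballI impI)
    show "\<Union> (R ` {..<m}) = {..<n}" using assms(1) by (auto simp: R_def)
    show "{} \<notin> R ` {..<m}" using memR by force
  qed (auto simp: R_def)
  with card show "R ` {..<m} \<in> part_set n m"
    by (auto simp: part_set_def card_image[OF inj])
qed

text \<open>The polynomial \<open>esym n i\<close> evaluated at the point \<open>v\<close>.\<close>

definition esym_val :: "nat \<Rightarrow> (nat \<Rightarrow> 'k::comm_ring_1) \<Rightarrow> nat \<Rightarrow> 'k" where
  "esym_val n v i = (\<Sum>S\<in>{S. S \<subseteq> {..<n} \<and> card S = i}. \<Prod>j\<in>S. v j)"

text \<open>The factor of \<open>Theta\<close> at the partition into residue classes contains,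
  through the factor \<open>P\<close> of \<open>Phi\<close>, the linear factor of
  \<open>Psi m\<close> with index \<open>k\<close>, and \<open>zero\<close> says that this one
  vanishes.\<close>

lemma theta_vanishes:
  fixes v :: "nat \<Rightarrow> 'k::idom" and \<omega> :: 'k
  assumes m: "m \<ge> 1" "m dvd n" "n \<ge> 1"
    and sp: "\<And>p. int_eval (zeta m) p = 0 \<Longrightarrow> int_eval \<omega> p = 0"
    and k: "k \<in> coprimes m"
    and zero: "(\<Sum>j<m. \<omega> ^ (k * j) * (\<Sum>i | i < n \<and> i mod m = j. v i)) = 0"
  shows "mpoly_ins of_int (esym_val n v) (theta n m) = 0"
proof -
  obtain P :: "int mpoly" where P: "int_emb P = Psi m" and
    P_eval: "\<And>(\<omega> :: 'k) (y :: nat \<Rightarrow> 'k). (\<And>p. int_eval (zeta m) p = 0 \<Longrightarrow> int_eval \<omega> p = 0) \<Longrightarrow>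
       mpoly_ins of_int y P = (\<Prod>i\<in>coprimes m. \<Sum>j<m. \<omega> ^ (i * j) * y j)"
    using Psi_integral[OF m(1)] by blast
  obtain R where R: "int_emb (P * R) = Phi m" using Phi_integral[OF P] .
  define T :: "int mpoly" where "T = (\<Prod>Q\<in>part_set n m. mpoly_ins of_int (\<lambda>j. if j < m then \<Sum>a\<in>blocks m Q j. mVar a else 0) (P * R))"
  have T: "int_emb T = Theta n m" unfolding T_def by (rule Theta_integral[OF R])
  interpret ev: unital_ring_hom "mpoly_ins of_int v :: int mpoly \<Rightarrow> 'k"
    by (rule unital_ring_hom_mpoly_ins[OF unital_ring_hom_of_int])
  have evV [simp]: "mpoly_ins of_int v (mVar a) = v a" for a
    by (simp add: unital_ring_hom_of_int)
  have "mpoly_ins of_int (esym_val n v) (theta n m) = mpoly_ins of_int v (mpoly_ins of_int (esym n) (theta n m))"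
    by (subst unital_ring_hom_mpoly_ins_int[OF ev.unital_ring_hom_axioms])
       (simp add: esym_def ev.sum ev.prod esym_val_def[abs_def])
  also have "\<dots> = mpoly_ins of_int v T" by (simp add: theta_spec[OF T])
  also have "\<dots> = (\<Prod>Q\<in>part_set n m. mpoly_ins of_int (\<lambda>j. if j < m then \<Sum>a\<in>blocks m Q j. v a else 0) (P * R))"
  proof -
    have "mpoly_ins of_int v (if j < m then \<Sum>a\<in>blocks m Q j. mVar a else 0) = (if j < m then \<Sum>a\<in>blocks m Q j. v a else 0)"
      for j and Q :: "nat set set"
      by (simp add: ev.sum)
    then show ?thesis
      by (simp add: T_def ev.prod unital_ring_hom_mpoly_ins_int[OF ev.unital_ring_hom_axioms])
  qed
  also have "\<dots> = 0"
  proof (rule prod_zero[OF finite_part_set])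
    define C where "C = (\<lambda>j. {i. i < n \<and> i mod m = j})"
    note cl = residue_classes_part_set[OF m, folded C_def]
    let ?y = "\<lambda>j. if j < m then \<Sum>a\<in>C j. v a else 0"
    have sym: "msymmetric m (P * R)"
      using msymmetric_Phi[of m] by (simp add: msymmetric_int_emb flip: R)
    have "mpoly_ins of_int (\<lambda>j. if j < m then \<Sum>a\<in>blocks m (C ` {..<m}) j. v a else 0) (P * R) =
        mpoly_ins of_int ?y (P * R)"
      by (rule msymmetric_mpoly_ins_bij[OF unital_ring_hom_of_int sym bij_betw_blocks[OF cl(1)] cl(2),
            where F="\<lambda>B. \<Sum>a\<in>B. v a"])
    also have "\<dots> = mpoly_ins of_int ?y P * mpoly_ins of_int ?y R"
      by (rule unital_ring_hom.mult[OF unital_ring_hom_mpoly_ins[OF unital_ring_hom_of_int]])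
    also have "mpoly_ins of_int ?y P = (\<Prod>i\<in>coprimes m. \<Sum>j<m. \<omega> ^ (i * j) * ?y j)"
      by (rule P_eval[OF sp])
    also have "\<dots> = 0"
      by (rule prod_zero) (use k zero in \<open>auto simp: C_def\<close>)
    finally show "\<exists>Q\<in>part_set n m. mpoly_ins of_int (\<lambda>j. if j < m then \<Sum>a\<in>blocks m Q j. v a else 0) (P * R) = 0"
      using cl(1) by auto
  qed
  finally show ?thesis .
qed

section \<open>Roots of irreducible polynomials over finite fields\<close>

text \<open>Vieta's formulas for the roots \<open>- v j\<close>, so that no signs appear.\<close>

lemma coeff_prod_linear:
  fixes v :: "nat \<Rightarrow> 'k::comm_ring_1"
  assumes "i \<le> n"
  shows "coeff (\<Prod>j<n. [:v j, 1:]) (n - i) = esym_val n v i"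
proof -
  have const: "(\<Prod>j\<in>S. pCons (v j) 0) = pCons (prod v S) 0" for S
    by (induction S rule: infinite_finite_induct) (simp_all add: one_pCons)
  have card: "card ({..<n} - S) = n - card S" "card S \<le> n" if "S \<subseteq> {..<n}" for S
    using that card_mono[of "{..<n}" S] by (simp_all add: card_Diff_subset finite_subset)
  have "(\<Prod>j<n. [:v j, 1:]) = (\<Prod>j<n. [:v j:] + [:0, 1:])" by simp
  also have "\<dots> = (\<Sum>S\<in>Pow {..<n}. (\<Prod>j\<in>S. [:v j:]) * (\<Prod>j\<in>{..<n} - S. [:0, 1:]))"
    by (rule prod_add) simp
  also have "\<dots> = (\<Sum>S\<in>Pow {..<n}. Polynomial.monom (\<Prod>j\<in>S. v j) (n - card S))"
    by (rule sum.cong) (simp_all add: const card flip: monom_altdef)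
  finally have "coeff (\<Prod>j<n. [:v j, 1:]) (n - i) =
      (\<Sum>S\<in>Pow {..<n}. if n - card S = n - i then \<Prod>j\<in>S. v j else 0)"
    by (simp add: coeff_sum)
  also have "\<dots> = esym_val n v i"
    unfolding esym_val_def
  proof (rule sum.mono_neutral_cong_right)
    show "\<forall>S\<in>Pow {..<n} - {S. S \<subseteq> {..<n} \<and> card S = i}. (if n - card S = n - i then \<Prod>j\<in>S. v j else 0) = 0"
    proof
      fix S assume "S \<in> Pow {..<n} - {S. S \<subseteq> {..<n} \<and> card S = i}"
      then have "card S \<le> n" "card S \<noteq> i" using card(2)[of S] by auto
      \<comment> \<open>Both numbers are at most \<open>n\<close>, so truncated subtraction from
        \<open>n\<close> separates them.\<close>
      with assms have "n - card S \<noteq> n - i" by linarith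
      then show "(if n - card S = n - i then \<Prod>j\<in>S. v j else 0) = 0" by simp
    qed
  qed auto
  finally show ?thesis .
qed

text \<open>Multiplication by a nonzero \<open>x\<close> permutes the nonzero elements; their
  product is compared before and after.\<close>

lemma finite_field_power_card:
  fixes x :: "'a::{field,finite}"
  shows "x ^ CARD('a) = x"
proof (cases "x = 0")
  case False
  have "x * (\<Prod>y\<in>UNIV-{0}. x * y) = x * x ^ (CARD('a) - 1) * \<Prod>(UNIV-{0})"
    by (simp add: prod.distrib mult_ac)
  also have "x * x ^ (CARD('a) - 1) = x ^ Suc (CARD('a) - 1)"
    by (subst power_Suc) auto
  also have "Suc (CARD('a) - 1) = CARD('a)"
    using finite_UNIV_card_ge_0[where ?'a = 'a] by simp
  also have "(\<Prod>y\<in>UNIV-{0}. x * y) = (\<Prod>y\<in>UNIV-{0}. y)"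
    by (rule prod.reindex_bij_witness[of _ "\<lambda>y. y / x" "\<lambda>y. x * y"]) (use False in auto)
  finally show ?thesis by simp
qed (use finite_UNIV_card_ge_0[where ?'a = 'a] in auto)

section \<open>Frobenius powers on an extension of the field with \<open>q\<close> elements\<close>

locale finite_field_embedding = unital_ring_hom \<phi>
  for \<phi> :: "'a::{field,finite} \<Rightarrow> 'b::field" +
  fixes q :: nat
  assumes q_card: "q = CARD('a)"
begin

lemma power_q_id: "x ^ q = x" for x :: 'a
  by (simp add: q_card finite_field_power_card)

lemma q_gt_1: "q > 1"
proof -
  have "card {0, 1 :: 'a} \<le> q" unfolding q_card by (rule card_mono) simp_all
  then show ?thesis by simp
qed

lemma hom_eq_0_iff: "\<phi> x = 0 \<longleftrightarrow> x = 0"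
proof
  assume "\<phi> x = 0"
  show "x = 0"
  proof (rule ccontr)
    assume "x \<noteq> 0"
    then have "1 = \<phi> (x * inverse x)" by simp
    also have "\<dots> = 0" using \<open>\<phi> x = 0\<close> by (simp only: mult) simp
    finally show False by simp
  qed
qed simp

text \<open>The polynomials \<open>(1 + X)\<^sup>q\<close> and \<open>1 + X\<^sup>q\<close> have the same leading term and agree on all
  \<open>q\<close> elements of the small field, so they are equal.\<close>

lemma power_q_add: "(x + y) ^ q = x ^ q + y ^ q" for x y :: 'b
proof (cases "y = 0")
  case True
  then show ?thesis using q_gt_1 by (simp add: power_0_left)
next
  case False
  have "[:1, 1:] ^ q = 1 + Polynomial.monom (1::'a) q"
  proof (rule poly_eqI_degree_lead_coeff[where A=UNIV and n=q])
    show "coeff ([:1, 1:] ^ q) q = coeff (1 + Polynomial.monom (1::'a) q) q"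
      using q_gt_1 lead_coeff_power[of "[:1, 1::'a:]" q] by (simp add: degree_power_eq)
    show "Polynomial.degree ([:1, 1::'a:] ^ q) \<le> q"
      by (simp add: degree_power_eq)
    show "Polynomial.degree (1 + Polynomial.monom (1::'a) q) \<le> q"
      by (rule degree_add_le) (simp_all add: degree_monom_le)
    show "poly ([:1, 1:] ^ q) z = poly (1 + Polynomial.monom 1 q) z" for z :: 'a
      by (simp add: poly_monom power_q_id)
  qed (simp add: q_card)
  then have eq: "map_poly \<phi> ([:1, 1:] ^ q) = map_poly \<phi> (1 + Polynomial.monom 1 q)" by simp
  interpret H: unital_ring_hom "map_poly \<phi>"
    by (rule unital_ring_hom_map_poly) (rule unital_ring_hom_axioms)
  from eq have "[:1, 1:] ^ q = 1 + Polynomial.monom (1::'b) q"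
    by (simp add: H.power H.add map_poly_monom map_poly_pCons)
  \<comment> \<open>Substituting \<open>x / y\<close> and multiplying by \<open>y ^ q\<close> turns
    the identity in one variable into the homogeneous one.\<close>
  then have "poly ([:1, 1:] ^ q) (x / y) = poly (1 + Polynomial.monom (1::'b) q) (x / y)" by simp
  then have "(1 + x / y) ^ q = 1 + (x / y) ^ q" by (simp add: poly_monom)
  then have "y ^ q * (1 + x / y) ^ q = y ^ q * (1 + (x / y) ^ q)" by simp
  also have "y ^ q * (1 + x / y) ^ q = (x + y) ^ q"
  proof -
    have "y * (1 + x / y) = x + y" using False by (simp add: field_simps)
    then show ?thesis by (simp only: power_mult_distrib[symmetric])
  qed
  also have "y ^ q * (1 + (x / y) ^ q) = x ^ q + y ^ q"
    using False by (simp add: field_simps power_divide)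
  finally show ?thesis .
qed

lemma frobenius_hom: "unital_ring_hom (\<lambda>x :: 'b. x ^ q ^ k)"
proof (induction k)
  case 0
  show ?case by standard simp_all
next
  case (Suc k)
  have "unital_ring_hom (\<lambda>x :: 'b. x ^ q)"
    by standard (simp_all add: power_q_add power_mult_distrib)
  from unital_ring_hom_comp[OF Suc this] show ?case
    by (simp add: power_mult)
qed

lemma frobenius_hom_fixes: "\<phi> a ^ q ^ k = \<phi> a"
  by (induction k) (simp_all add: power_mult power_q_id flip: power)

text \<open>The Frobenius powers are homomorphisms fixing the coefficients of
  \<open>map_poly \<phi> g\<close>.\<close>

lemma frobenius_poly: "poly (map_poly \<phi> g) (x ^ q ^ k) = poly (map_poly \<phi> g) x ^ q ^ k"
proof -
  interpret F: unital_ring_hom "\<lambda>x :: 'b. x ^ q ^ k" by (rule frobenius_hom)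
  show ?thesis
    by (induction g) (simp_all add: map_poly_pCons F.add F.mult frobenius_hom_fixes F.zero del: power_eq_0_iff)
qed

lemma frobenius_inj: "x ^ q ^ k = y ^ q ^ k \<Longrightarrow> x = y" for x y :: 'b
  using unital_ring_hom.diff[OF frobenius_hom, of x y k] q_gt_1 by simp

end

text \<open>Only one root \<open>r\<close> in \<open>'b\<close> is assumed; its conjugates
  \<open>u i\<close> will supply all the others.\<close>

locale irreducible_root = finite_field_embedding \<phi> q
  for \<phi> :: "'a::{field,finite} \<Rightarrow> 'b::field" and q +
  fixes f :: "'a poly" and n :: nat and r :: 'b
  assumes deg: "Polynomial.degree f = n" and n: "n \<ge> 1" and monic: "lead_coeff f = 1"
    and irred: "irreducible f" and root: "poly (map_poly \<phi> f) r = 0"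
begin

interpretation H: unital_ring_hom "map_poly \<phi>"
  by (rule unital_ring_hom_map_poly) (rule unital_ring_hom_axioms)

text \<open>A nonzero polynomial of least degree vanishing at \<open>r\<close> divides
  \<open>f\<close>, and irreducibility forces its degree to be \<open>n\<close>.\<close>

lemma small_degree_not_root:
  assumes "poly (map_poly \<phi> g) r = 0" "Polynomial.degree g < n"
  shows "g = 0"
proof (rule ccontr)
  assume "g \<noteq> 0"
  define Q where "Q = (\<lambda>p. p \<noteq> 0 \<and> poly (map_poly \<phi> p) r = 0)"
  define s where "s = arg_min Polynomial.degree Q"
  have "Q g" using assms \<open>g \<noteq> 0\<close> by (simp add: Q_def)
  then have s: "Q s" "\<And>p. Q p \<Longrightarrow> Polynomial.degree s \<le> Polynomial.degree p"
    unfolding s_def using arg_min_nat_lemma[of Q g Polynomial.degree] by auto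
  have "map_poly \<phi> f = map_poly \<phi> s * map_poly \<phi> (f div s) + map_poly \<phi> (f mod s)"
    by (metis H.add H.mult mult_div_mod_eq)
  then have "poly (map_poly \<phi> (f mod s)) r = 0"
    using s(1) root by (simp add: Q_def)
  then have "f mod s = 0"
    using s(2)[of "f mod s"] degree_mod_less[of s f] s(1) unfolding Q_def by (meson not_le)
  then obtain t where t: "f = s * t" by (auto simp: mod_eq_0_iff_dvd)
  with irred have "s dvd 1 \<or> t dvd 1" by (simp add: irreducible_def)
  then show False
  proof
    assume "s dvd 1"
    then obtain a where "s = [:a:]" "a \<noteq> 0"
      using s(1) by (auto simp: is_unit_poly_iff Q_def)
    with s(1) show False by (simp add: Q_def map_poly_pCons hom_eq_0_iff)
  next
    assume "t dvd 1"
    then have "Polynomial.degree t = 0" by (auto simp: is_unit_poly_iff)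
    moreover have "t \<noteq> 0" "s \<noteq> 0" using t monic by auto
    ultimately have "Polynomial.degree s = n" using deg t by (simp add: degree_mult_eq)
    with s(2)[OF \<open>Q g\<close>] assms(2) show False by simp
  qed
qed

text \<open>The \<open>q\<^sup>n\<close> values at \<open>r\<close> of polynomials of degree less than \<open>n\<close> are all roots of
  \<open>X\<^bsup>q^d\<^esup> - X\<close>.\<close>

lemma frobenius_period_ge:
  assumes "r ^ q ^ d = r" "d > 0"
  shows "n \<le> d"
proof -
  \<comment> \<open>Coefficient lists of length \<open>n\<close> represent the polynomials of degree
    below \<open>n\<close>, which makes their number \<open>q ^ n\<close> immediate.\<close>
  define A where "A = {xs :: 'a list. set xs \<subseteq> UNIV \<and> length xs = n}"
  define e where "e = (\<lambda>xs. poly (map_poly \<phi> (Poly xs)) r)"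
  have "inj_on e A"
  proof (rule inj_onI)
    fix xs ys assume A: "xs \<in> A" "ys \<in> A" and eq: "e xs = e ys"
    have "Polynomial.degree (Poly xs - Poly ys) < n"
      using A n by (intro degree_diff_less degree_lessI) (auto simp: A_def nth_default_def)
    moreover have "poly (map_poly \<phi> (Poly xs - Poly ys)) r = 0"
      using eq by (simp add: e_def H.diff)
    ultimately have "Poly xs = Poly ys"
      using small_degree_not_root by (metis right_minus_eq)
    then have "nth_default 0 xs = nth_default 0 ys" by (metis coeff_Poly_eq)
    then show "xs = ys"
      using A by (intro nth_equalityI) (auto simp: A_def nth_default_def fun_eq_iff dest: spec split: if_splits)
  qed
  moreover have "card A = q ^ n"
    unfolding A_def q_card by (rule card_lists_length_eq) simp
  ultimately have "card (e ` A) = q ^ n" by (simp add: card_image)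
  define P where "P = Polynomial.monom 1 (q ^ d) - Polynomial.monom (1::'b) 1"
  have qd: "q ^ d > 1" using q_gt_1 assms(2) by (rule one_less_power)
  have "coeff P (q ^ d) = 1" using qd by (simp add: P_def)
  then have "P \<noteq> 0" by auto
  have degP: "Polynomial.degree P \<le> q ^ d"
    unfolding P_def using qd by (intro degree_diff_le order_trans[OF degree_monom_le]) auto
  have "e ` A \<subseteq> {x. poly P x = 0}"
  proof clarify
    fix xs
    have "e xs ^ q ^ d = e xs" unfolding e_def by (simp add: assms(1) flip: frobenius_poly)
    then show "poly P (e xs) = 0" by (simp add: P_def poly_monom)
  qed
  then have "card (e ` A) \<le> card {x. poly P x = 0}"
    by (intro card_mono poly_roots_finite \<open>P \<noteq> 0\<close>)
  also have "\<dots> \<le> q ^ d" using card_poly_roots_bound[OF \<open>P \<noteq> 0\<close>] degP by simp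
  finally have "q ^ n \<le> q ^ d" by (simp add: \<open>card (e ` A) = q ^ n\<close>)
  with q_gt_1 show ?thesis by (simp add: power_increasing_iff)
qed

abbreviation u :: "nat \<Rightarrow> 'b" where "u i \<equiv> r ^ q ^ i"

lemma u_add: "u (i + k) = u i ^ q ^ k"
  by (simp add: power_add power_mult)

text \<open>Injectivity of the Frobenius powers cancels \<open>i\<close> steps on both
  sides.\<close>

lemma u_eq_imp_period:
  assumes "i \<le> j" "u i = u j"
  shows "u (j - i) = r"
  using assms u_add[of "j - i" i] frobenius_inj[of "u (j - i)" i r] by simp

lemma u_inj: "inj_on u {..<n}"
proof (rule linorder_inj_onI')
  fix i j assume ij: "i \<in> {..<n}" "j \<in> {..<n}" "i < j"
  show "u i \<noteq> u j"
  proof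
    assume "u i = u j"
    then have "u (j - i) = r" using ij by (intro u_eq_imp_period) simp_all
    then have "n \<le> j - i" using ij by (intro frobenius_period_ge) simp_all
    with ij show False by simp
  qed
qed

lemma u_root: "poly (map_poly \<phi> f) (u i) = 0"
  using root q_gt_1 by (simp add: frobenius_poly power_0_left)

text \<open>The \<open>n\<close> distinct conjugates already exhaust the degree, so \<open>f\<close>
  splits over \<open>'b\<close>.\<close>

lemma map_poly_eq_prod: "map_poly \<phi> f = (\<Prod>i<n. [:- u i, 1:])"
proof (rule monic_eq_prod_roots)
  show d: "Polynomial.degree (map_poly \<phi> f) = n"
    using deg by (subst degree_map_poly) (simp_all add: hom_eq_0_iff)
  show "lead_coeff (map_poly \<phi> f) = 1"
    using monic deg by (simp add: d coeff_map_poly)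
qed (use u_inj u_root in auto)

lemma roots_eq: "{x. poly (map_poly \<phi> f) x = 0} = u ` {..<n}"
  by (auto simp: map_poly_eq_prod poly_prod)

text \<open>\<open>u n\<close> is a root of \<open>f\<close>, hence equal to some \<open>u j\<close>
  with \<open>j < n\<close>. Then \<open>n - j\<close> is a period of \<open>r\<close>, and periods
  are at least \<open>n\<close>, so \<open>j = 0\<close>.\<close>

lemma u_period: "u (i + n) = u i"
proof -
  from u_root[of n] obtain j where j: "j < n" "u n = u j" using roots_eq by blast
  then have "u (n - j) = r" by (intro u_eq_imp_period) simp_all
  with j have "n \<le> n - j" by (intro frobenius_period_ge) simp_all
  with j have "j = 0" by linarith
  with j have "u n = r" by simp
  then show ?thesis using u_add[of n i] by (simp add: add.commute)
qed

end

section \<open>Linear recurrences of period \<open>n\<close>\<close>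

text \<open>The polynomial acts on sequences with \<open>X\<close> as the shift;
  \<open>recur p u\<close> is the sequence obtained by applying \<open>p\<close> to
  \<open>u\<close>.\<close>

definition recur :: "'k::comm_ring_1 poly \<Rightarrow> (nat \<Rightarrow> 'k) \<Rightarrow> nat \<Rightarrow> 'k" where
  "recur p u k = (\<Sum>i\<le>Polynomial.degree p. coeff p i * u (i + k))"

lemma recur_superset: "Polynomial.degree p \<le> N \<Longrightarrow> recur p u k = (\<Sum>i\<le>N. coeff p i * u (i + k))"
  unfolding recur_def by (intro sum.mono_neutral_left) (auto simp: coeff_eq_0)

lemma recur_add: "recur (p + q) u k = recur p u k + recur q u k"
proof -
  let ?N = "max (Polynomial.degree p) (Polynomial.degree q)"
  show ?thesis
    by (simp add: recur_superset[of _ ?N] degree_add_le_max distrib_right sum.distrib)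
qed

lemma recur_smult: "recur (smult a p) u k = a * recur p u k"
  by (subst recur_superset[OF degree_smult_le]) (simp add: recur_def sum_distrib_left mult.assoc)

lemma recur_pCons: "recur (pCons a p) u k = a * u k + recur p u (Suc k)"
  by (simp add: recur_superset[OF degree_pCons_le] recur_def sum.atMost_Suc_shift del: sum.atMost_Suc)

text \<open>Together with \<open>recur_add\<close> it makes the annihilators of \<open>u\<close> an
  ideal, so that division by an annihilator of least degree is meaningful.\<close>

lemma recur_mult:
  assumes "\<And>k. recur p u k = 0"
  shows "recur (p * q) u k = 0"
  by (induction q arbitrary: k) (simp_all add: recur_add recur_smult recur_pCons assms, simp add: recur_def)

lemma recur_monom: "recur (Polynomial.monom a i) u k = a * u (i + k)"
  by (induction i arbitrary: k) (simp_all add: monom_0 monom_Suc recur_pCons, simp_all add: recur_def)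

lemma periodic_recurrence_character:
  fixes u :: "nat \<Rightarrow> 'k::alg_closed_field"
  assumes n: "n \<ge> 1" and per: "\<And>i. u (i + n) = u i"
    and g: "g \<noteq> 0" "Polynomial.degree g < n" "\<And>k. recur g u k = 0"
  obtains \<epsilon> where "\<epsilon> ^ n = 1" "(\<Sum>i<n. \<epsilon> ^ i * u i) = 0"
proof -
  define Q where "Q = (\<lambda>p. p \<noteq> 0 \<and> (\<forall>k. recur p u k = 0))"
  define s where "s = arg_min Polynomial.degree Q"
  have "Q g" using g by (simp add: Q_def)
  then have s: "Q s" "\<And>p. Q p \<Longrightarrow> Polynomial.degree s \<le> Polynomial.degree p"
    unfolding s_def using arg_min_nat_lemma[of Q g Polynomial.degree] by auto
  have degs: "Polynomial.degree s < n" using s(2)[OF \<open>Q g\<close>] g(2) by simp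
  have rs: "recur (s * p) u k = 0" for p k
    using s(1) by (intro recur_mult) (simp add: Q_def)
  \<comment> \<open>\<open>G\<close> is \<open>X^n - 1\<close>, written as a sum of monomials to
    suit \<open>recur_monom\<close>; it annihilates \<open>u\<close> by periodicity.\<close>
  define G where "G = Polynomial.monom (1::'k) n + Polynomial.monom (-1) 0"
  have G: "recur G u k = 0" for k
    using per[of k] by (simp add: G_def recur_add recur_monom add.commute)
  have "G = s * (G div s) + G mod s" by simp
  then have "recur (G mod s) u k = 0" for k
    using G rs recur_add[of "s * (G div s)" "G mod s" u k] by simp
  then have "G mod s = 0"
    using s(2)[of "G mod s"] degree_mod_less[of s G] s(1) unfolding Q_def by (meson not_le)
  then obtain t where t: "G = s * t" by (auto simp: mod_eq_0_iff_dvd)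
  have coX: "coeff G n = 1" using n by (simp add: G_def)
  then have "G \<noteq> 0" by auto
  have "n \<le> Polynomial.degree G" using coX by (intro le_degree) simp
  also have "\<dots> = Polynomial.degree s + Polynomial.degree t"
    using t \<open>G \<noteq> 0\<close> by (simp add: degree_mult_eq)
  finally have "Polynomial.degree t > 0" using degs by simp
  \<comment> \<open>The root is taken from the cofactor \<open>t\<close>, so that \<open>s\<close>
    still divides the quotient of \<open>G\<close> by \<open>X - \<delta>\<close>, which therefore
    annihilates \<open>u\<close>.\<close>
  then obtain \<delta> where "poly t \<delta> = 0" using alg_closed_imp_poly_has_root by blast
  then obtain w where w: "t = [:- \<delta>, 1:] * w" by (auto simp: poly_eq_0_iff_dvd)
  have "poly G \<delta> = 0" using t w by simp
  then have \<delta>n: "\<delta> ^ n = 1" by (simp add: G_def poly_monom)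
  then have \<delta>0: "\<delta> \<noteq> 0" using n by (auto simp: power_0_left)
  \<comment> \<open>The quotient of \<open>X^n - 1\<close> by \<open>X - \<delta>\<close>, written
    out as a geometric sum.\<close>
  define p where "p = (\<Sum>i<n. Polynomial.monom (\<delta> ^ (n - Suc i)) i)"
  have "[:- \<delta>, 1:] * (s * w) = G" unfolding t w by (rule mult.left_commute)
  also have "G = Polynomial.monom 1 1 ^ n - [:\<delta>:] ^ n"
    by (simp add: G_def monom_power poly_const_pow \<delta>n monom_0 one_pCons)
  also have "\<dots> = (Polynomial.monom 1 1 - [:\<delta>:]) * (\<Sum>i<n. [:\<delta>:] ^ (n - Suc i) * Polynomial.monom 1 1 ^ i)"
    by (rule power_diff_sumr2)
  also have "Polynomial.monom 1 1 - [:\<delta>:] = [:- \<delta>, 1:]" by (simp add: monom_Suc monom_0)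
  also have "(\<Sum>i<n. [:\<delta>:] ^ (n - Suc i) * Polynomial.monom 1 1 ^ i) = p"
    by (simp add: p_def poly_const_pow monom_power smult_monom)
  finally have "s * w = p" by (subst (asm) mult_cancel_left) simp
  have "0 = recur p u 0" using rs[of w 0] \<open>s * w = p\<close> by simp
  also have "\<dots> = (\<Sum>i<n. \<delta> ^ (n - Suc i) * u i)"
  proof -
    have "recur (\<Sum>i\<in>A. Polynomial.monom (\<delta> ^ (n - Suc i)) i) u 0 = (\<Sum>i\<in>A. \<delta> ^ (n - Suc i) * u i)" if "finite A" for A
      using that by (induction A) (simp_all add: recur_add recur_monom, simp add: recur_def)
    then show ?thesis by (simp add: p_def)
  qed
  finally have sum0: "(\<Sum>i<n. \<delta> ^ (n - Suc i) * u i) = 0" by simp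
  \<comment> \<open>As \<open>\<delta> ^ n = 1\<close>, the coefficients of \<open>p\<close> are the
    powers of \<open>inverse \<delta>\<close> up to a common factor, so
    \<open>inverse \<delta>\<close> is the wanted \<open>\<epsilon>\<close>.\<close>
  have inv: "inverse \<delta> ^ i = \<delta> * \<delta> ^ (n - Suc i)" if "i < n" for i
  proof -
    have "\<delta> ^ i * (\<delta> * \<delta> ^ (n - Suc i)) = \<delta> ^ (i + Suc (n - Suc i))" by (simp add: power_add)
    also have "i + Suc (n - Suc i) = n" using that by simp
    finally show ?thesis using \<delta>n \<delta>0 by (simp add: field_simps power_inverse)
  qed
  have "(\<Sum>i<n. inverse \<delta> ^ i * u i) = \<delta> * (\<Sum>i<n. \<delta> ^ (n - Suc i) * u i)"
    unfolding sum_distrib_left by (rule sum.cong) (simp_all add: inv mult.assoc)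
  with sum0 have "(\<Sum>i<n. inverse \<delta> ^ i * u i) = 0" by simp
  moreover have "inverse \<delta> ^ n = 1" using \<delta>n by (simp add: power_inverse)
  ultimately show ?thesis using that by blast
qed

section \<open>From a character relation to the vanishing of \<open>theta\<close>\<close>

lemma exact_order:
  fixes \<epsilon> :: "'k::field"
  assumes "n \<ge> 1" "\<epsilon> ^ n = 1"
  obtains m where "m \<ge> 1" "m dvd n" "\<epsilon> ^ m = 1" "\<And>l. l \<ge> 1 \<Longrightarrow> \<epsilon> ^ l = 1 \<Longrightarrow> m \<le> l"
proof -
  define m where "m = (LEAST m. m \<ge> 1 \<and> \<epsilon> ^ m = 1)"
  have m: "m \<ge> 1 \<and> \<epsilon> ^ m = 1" unfolding m_def by (rule LeastI[of _ n]) (use assms in simp)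
  have min: "m \<le> l" if "l \<ge> 1" "\<epsilon> ^ l = 1" for l
    unfolding m_def by (rule Least_le) (use that in simp)
  have "\<epsilon> ^ n = \<epsilon> ^ (m * (n div m) + n mod m)" by simp
  then have "\<epsilon> ^ (n mod m) = 1" using assms m by (simp only: power_add power_mult) simp
  moreover have "n mod m < m" using m by simp
  ultimately have "n mod m = 0" using min[of "n mod m"] by (cases "n mod m = 0") auto
  then show ?thesis using that[of m] m min by (auto simp: mod_eq_0_iff_dvd)
qed

text \<open>The witness \<open>m\<close> is the exact order of \<open>\<epsilon>\<close>. Then
  \<open>\<epsilon>\<close> is a power of \<open>\<omega>\<close> with exponent coprime to
  \<open>m\<close>, as the index set of the product \<open>Psi m\<close> requires, and
  \<open>\<epsilon> ^ i\<close> depends only on \<open>i mod m\<close>, which allows grouping by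
  residues.\<close>

lemma character_relation_imp_theta_vanishes:
  fixes v :: "nat \<Rightarrow> 'k::alg_closed_field"
  assumes n: "n \<ge> 1" and \<epsilon>: "\<epsilon> ^ n = 1" "(\<Sum>i<n. \<epsilon> ^ i * v i) = 0"
  obtains m where "m dvd n" "mpoly_ins of_int (esym_val n v) (theta n m) = 0"
proof -
  obtain m where m: "m \<ge> 1" "m dvd n" "\<epsilon> ^ m = 1" and min: "\<And>l. l \<ge> 1 \<Longrightarrow> \<epsilon> ^ l = 1 \<Longrightarrow> m \<le> l"
    using exact_order[OF n \<epsilon>(1)] by blast
  obtain \<omega> :: 'k where sp: "\<And>p. int_eval (zeta m) p = 0 \<Longrightarrow> int_eval \<omega> p = 0"
    using root_of_unity_specialization[OF zeta_pow_self[OF m(1)] m(1)] by blast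
  obtain k where k: "k < m" "\<epsilon> = \<omega> ^ k"
    using specialization_roots_of_unity[OF m(1) sp m(3)] by blast
  have "int_eval (zeta m) (Polynomial.monom 1 m - 1) = 0"
    by (simp add: int_eval.diff zeta_pow_self[OF m(1)])
  from sp[OF this] have \<omega>m: "\<omega> ^ m = 1" by (simp add: int_eval.diff)
  \<comment> \<open>With \<open>g = gcd k m\<close> the power \<open>\<epsilon> ^ (m div g)\<close>
    is 1, and minimality of \<open>m\<close> leaves only \<open>g = 1\<close>.\<close>
  have "coprime k m"
  proof -
    define g where "g = gcd k m"
    have g: "g dvd k" "g dvd m" "g > 0" using m(1) by (auto simp: g_def)
    then obtain a b where ab: "k = g * a" "m = g * b" by (auto elim!: dvdE)
    have "\<epsilon> ^ b = \<omega> ^ (m * a)" using k ab by (simp add: mult_ac flip: power_mult)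
    also have "\<dots> = 1" by (simp add: power_mult \<omega>m)
    finally have "m \<le> b" using ab m(1) by (intro min) (auto intro: Suc_leI Nat.gr0I)
    with ab m(1) g(3) have "g = 1" by (cases "g = 1") auto
    then show ?thesis by (simp add: g_def coprime_iff_gcd_eq_1)
  qed
  with k have kc: "k \<in> coprimes m" by simp
  have "(\<Sum>j<m. \<omega> ^ (k * j) * (\<Sum>i | i < n \<and> i mod m = j. v i)) =
      (\<Sum>j<m. \<Sum>i | i \<in> {..<n} \<and> i mod m = j. \<epsilon> ^ i * v i)"
  proof (rule sum.cong[OF refl])
    fix j
    have "\<epsilon> ^ i = \<omega> ^ (k * j)" if "i mod m = j" for i
    proof -
      have "\<epsilon> ^ i = \<epsilon> ^ (m * (i div m) + i mod m)" by simp
      also have "\<dots> = \<epsilon> ^ j" using that by (simp only: power_add power_mult m(3)) simp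
      finally show ?thesis by (simp add: k(2) power_mult)
    qed
    then show "\<omega> ^ (k * j) * (\<Sum>i | i < n \<and> i mod m = j. v i) = (\<Sum>i | i \<in> {..<n} \<and> i mod m = j. \<epsilon> ^ i * v i)"
      by (simp add: sum_distrib_left)
  qed
  also have "\<dots> = (\<Sum>i<n. \<epsilon> ^ i * v i)"
    using m(1) by (intro sum.group) auto
  finally show ?thesis
    using that[OF m(2)] theta_vanishes[OF m(1,2) n sp kc] \<epsilon>(2) by simp
qed

theorem theorem3p1:
  fixes f :: "'a::{field,finite} poly" and n :: nat and \<phi> :: "'a \<Rightarrow> 'b::field"
  assumes "n \<ge> 1"
    and "Polynomial.degree f = n" and "lead_coeff f = 1"
    and "irreducible f"
    and "mpoly_ins of_int (\<lambda>i. coeff f (n - i)) (h n) \<noteq> 0"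
    and "\<forall>x y. \<phi> (x + y) = \<phi> x + \<phi> y" and "\<forall>x y. \<phi> (x * y) = \<phi> x * \<phi> y" and "\<phi> 1 = 1"
  shows "\<forall>c :: 'b \<Rightarrow> 'a.
           (\<Sum>r\<in>{r. poly (map_poly \<phi> f) r = 0}. \<phi> (c r) * r) = 0
             \<longrightarrow> (\<forall>r. poly (map_poly \<phi> f) r = 0 \<longrightarrow> c r = 0)"
proof (intro allI impI, rule ccontr)
  fix c :: "'b \<Rightarrow> 'a" and r :: 'b
  assume rel: "(\<Sum>r\<in>{r. poly (map_poly \<phi> f) r = 0}. \<phi> (c r) * r) = 0"
    and root: "poly (map_poly \<phi> f) r = 0" and c: "c r \<noteq> 0"
  interpret irreducible_root \<phi> "CARD('a)" f n r
    by unfold_locales (use assms root in simp_all)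
  \<comment> \<open>The field \<open>'b\<close> need not contain the required roots of unity, so
    everything is moved to its algebraic closure.\<close>
  define \<kappa> where "\<kappa> = (\<lambda>a. to_ac (\<phi> a))"
  have ac_hom: "unital_ring_hom (to_ac :: 'b \<Rightarrow> 'b alg_closure)" by standard simp_all
  then have \<kappa>_hom: "unital_ring_hom \<kappa>"
    unfolding \<kappa>_def using unital_ring_hom_axioms by (rule unital_ring_hom_comp)
  \<comment> \<open>Negated, because the coefficients of \<open>f\<close> are the elementary symmetric functions of \<open>- u i\<close>.\<close>
  define v where "v = (\<lambda>i. to_ac (- u i))"
  define g where "g = (\<Sum>i<n. Polynomial.monom (\<kappa> (c (u i))) i)"
  have cg: "coeff g i = (if i < n then \<kappa> (c (u i)) else 0)" for i
    by (auto simp: g_def coeff_sum)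
  \<comment> \<open>Since \<open>u 0\<close> is \<open>r\<close>, the constant coefficient comes
    from \<open>c r\<close>, which is nonzero by the choice of \<open>r\<close>.\<close>
  have "coeff g 0 \<noteq> 0" using n c by (simp add: cg \<kappa>_def hom_eq_0_iff)
  then have "g \<noteq> 0" by auto
  have degg: "Polynomial.degree g < n" using n by (intro degree_lessI) (auto simp: cg)
  have "recur g v k = 0" for k
  proof -
    interpret F: unital_ring_hom "\<lambda>x :: 'b. x ^ CARD('a) ^ k" by (rule frobenius_hom)
    \<comment> \<open>The Frobenius power fixes the coefficients of the relation and shifts the
      conjugates by \<open>k\<close>.\<close>
    have "0 = (\<Sum>i<n. \<phi> (c (u i)) * u i) ^ CARD('a) ^ k"
      using rel q_gt_1 by (simp add: roots_eq sum.reindex[OF u_inj] power_0_left)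
    also have "\<dots> = (\<Sum>i<n. \<phi> (c (u i)) * u (i + k))"
      by (simp only: F.sum F.mult frobenius_hom_fixes u_add)
    finally have *: "(\<Sum>i<n. \<phi> (c (u i)) * u (i + k)) = 0" by simp
    have "recur g v k = (\<Sum>i\<le>n - 1. coeff g i * v (i + k))"
      using degg by (intro recur_superset) simp
    also have "\<dots> = (\<Sum>i<n. \<kappa> (c (u i)) * v (i + k))"
      using n by (intro sum.cong) (auto simp: cg)
    also have "\<dots> = to_ac (- (\<Sum>i<n. \<phi> (c (u i)) * u (i + k)))"
      by (simp add: \<kappa>_def v_def to_ac_sum sum_negf)
    finally show ?thesis using * by simp
  qed
  moreover have "v (i + n) = v i" for i unfolding v_def u_period ..
  ultimately obtain \<epsilon> where "\<epsilon> ^ n = 1" "(\<Sum>i<n. \<epsilon> ^ i * v i) = 0"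
    using periodic_recurrence_character[OF n, of v g] \<open>g \<noteq> 0\<close> degg by blast
  then obtain m where m: "m dvd n" "mpoly_ins of_int (esym_val n v) (theta n m) = 0"
    using character_relation_imp_theta_vanishes[OF n] by blast
  have coeffs: "\<kappa> (coeff f (n - i)) = esym_val n v i" if "i \<le> n" for i
  proof -
    interpret A: unital_ring_hom "map_poly (to_ac :: 'b \<Rightarrow> 'b alg_closure)"
      by (rule unital_ring_hom_map_poly[OF ac_hom])
    have "\<kappa> (coeff f (n - i)) = coeff (map_poly to_ac (map_poly \<phi> f)) (n - i)"
      by (simp add: \<kappa>_def coeff_map_poly)
    also have "map_poly to_ac (map_poly \<phi> f) = (\<Prod>i<n. [:v i, 1:])"
      by (simp add: map_poly_eq_prod A.prod map_poly_pCons v_def)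
    finally show ?thesis using that by (simp add: coeff_prod_linear)
  qed
  \<comment> \<open>\<open>coeffs\<close> covers only \<open>i \<le> n\<close>; beyond that,
    truncated subtraction returns the constant coefficient of \<open>f\<close>. Hence the need to
    know that only the variables \<open>1..n\<close> occur in \<open>theta n m\<close>.\<close>
  have "m \<ge> 1" using m(1) n by (auto intro!: Suc_leI Nat.gr0I)
  then obtain P :: "int mpoly" where "int_emb P = Psi m"
    using Psi_integral[where 'k=complex, of m] by blast
  then obtain R where "int_emb (P * R) = Phi m" by (rule Phi_integral)
  note vars = theta_spec(1)[OF Theta_integral[OF this]]
  have "\<kappa> (mpoly_ins of_int (\<lambda>i. coeff f (n - i)) (theta n m)) =
      mpoly_ins of_int (\<lambda>i. \<kappa> (coeff f (n - i))) (theta n m)"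
    by (rule unital_ring_hom_mpoly_ins_int[OF \<kappa>_hom])
  also have "\<dots> = mpoly_ins of_int (esym_val n v) (theta n m)"
    using vars[of n] by (intro mpoly_ins_cong_vars coeffs) auto
  finally have zero: "mpoly_ins of_int (\<lambda>i. coeff f (n - i)) (theta n m) = 0"
    using m(2) by (simp add: \<kappa>_def hom_eq_0_iff)
  have "mpoly_ins of_int (\<lambda>i. coeff f (n - i)) (h n) =
      (\<Prod>m\<in>{m. m dvd n}. mpoly_ins of_int (\<lambda>i. coeff f (n - i)) (theta n m))"
    unfolding h_def by (rule unital_ring_hom.prod[OF unital_ring_hom_mpoly_ins[OF unital_ring_hom_of_int]])
  also have "\<dots> = 0"
    by (rule prod_zero) (use n m(1) zero in auto)
  finally show False using assms(5) by simp
qed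

end
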